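(* Let $B$ be a (commutative, unitary) ring and $a,b,c\in B$. Then the $B$-algebra $A=B[X,Y]/(aX^2+bXY+cY^2-1)$ is smooth over $B$ if and only if $a,c\in\sqrt{(2,b)B}$.
   Context: All rings are commutative and unitary. $\sqrt{I}$ denotes the radical of an ideal $I$, and $(2,b)B$ is the ideal of $B$ generated by $2$ and $b$. *)

theory Defs
  imports "HOL-Algebra.Algebra"
begin

text \<open>A commutative \<open>B\<close>-algebra \<open>A\<close> is a structure map \<open>\<phi>\<close> with \<open>ring_hom_cring B A \<phi>\<close>;
  the zero ring is allowed, as \<^locale>\<open>cring\<close> does not require \<open>\<one> \<noteq> \<zero>\<close>.\<close>


section \<open>Polynomial rings in several variables\<close>

text \<open>The ring \<open>R[X\<^sub>i | i \<in> I]\<close>. The carrier, the addition, the constants and the variables are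
  those of \<^theory>\<open>HOL-Algebra.Indexed_Polynomials\<close>, where a polynomial is the function
  mapping each monomial (a multiset of indices) to its coefficient. The library has no product of two
  such polynomials.\<close>

definition indexed_poly_ring ::
    "('b, 'm) ring_scheme \<Rightarrow> 'i set \<Rightarrow> ('i multiset \<Rightarrow> 'b) ring"
  where "indexed_poly_ring R I =
    \<lparr> carrier = ring.indexed_pset R I (carrier R),
      monoid.mult = (\<lambda>p q m. \<Oplus>\<^bsub>R\<^esub>k \<in> {k. k \<subseteq># m}. p k \<otimes>\<^bsub>R\<^esub> q (m - k)),
      one = ring.indexed_const R \<one>\<^bsub>R\<^esub>,
      ring.zero = ring.indexed_const R \<zero>\<^bsub>R\<^esub>,
      ring.add = ring.indexed_padd R \<rparr>"


section \<open>Smooth algebras\<close>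

text \<open>\<open>A \<cong> B[X\<^sub>0, \<dots>, X\<^sub>n\<^sub>-\<^sub>1]/(S)\<close> as \<open>B\<close>-algebras, with \<open>S\<close> finite.\<close>

definition finitely_presented ::
    "('b, 'm) ring_scheme \<Rightarrow> ('a, 'n) ring_scheme \<Rightarrow> ('b \<Rightarrow> 'a) \<Rightarrow> bool"
  where "finitely_presented B A \<phi> \<longleftrightarrow>
    (\<exists>(n::nat) S h. let P = indexed_poly_ring B {..<n} in
        finite S \<and> S \<subseteq> carrier P \<and>
        h \<in> ring_iso (P Quot (Idl\<^bsub>P\<^esub> S)) A \<and>
        (\<forall>r \<in> carrier B. h (Idl\<^bsub>P\<^esub> S +>\<^bsub>P\<^esub> ring.indexed_const B r) = \<phi> r))"

text \<open>Infinitesimal lifting for one test ring \<open>C\<close>: for every \<open>B\<close>-algebra structure \<open>\<psi>\<close> on \<open>C\<close> and every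
  ideal \<open>J\<close> of \<open>C\<close> with \<open>J\<^sup>2 = 0\<close>, each \<open>B\<close>-algebra homomorphism \<open>u : A \<rightarrow> C/J\<close> lifts to a
  \<open>B\<close>-algebra homomorphism \<open>v : A \<rightarrow> C\<close>.\<close>

definition infinitesimal_lifting ::
    "('b, 'm) ring_scheme \<Rightarrow> ('a, 'n) ring_scheme \<Rightarrow> ('b \<Rightarrow> 'a) \<Rightarrow> 'c ring \<Rightarrow> bool"
  where "infinitesimal_lifting B A \<phi> C \<longleftrightarrow>
    (\<forall>\<psi> J u.
        ring_hom_cring B C \<psi> \<and> ideal J C \<and>
        (\<forall>x \<in> J. \<forall>y \<in> J. x \<otimes>\<^bsub>C\<^esub> y = \<zero>\<^bsub>C\<^esub>) \<and>
        u \<in> ring_hom A (C Quot J) \<and>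
        (\<forall>r \<in> carrier B. u (\<phi> r) = J +>\<^bsub>C\<^esub> \<psi> r) \<longrightarrow>
      (\<exists>v \<in> ring_hom A C.
        (\<forall>r \<in> carrier B. v (\<phi> r) = \<psi> r) \<and>
        (\<forall>x \<in> carrier A. J +>\<^bsub>C\<^esub> v x = u x)))"

text \<open>Formal smoothness quantifies over all rings \<open>C\<close>. In HOL a definition can only quantify over
  rings on a fixed type; the type below is large enough for this to be no restriction, because a
  lifting problem over \<open>C\<close> can be solved in the subring of \<open>C\<close> generated by the image of \<open>B\<close> and by
  one representative of \<open>u x\<close> for each \<open>x\<close> in \<open>A\<close>. The lemma \<open>formally_smooth_lifting\<close> below proves
  the lifting property for test rings on an arbitrary type.\<close>

definition formally_smooth ::
    "('b, 'm) ring_scheme \<Rightarrow> ('a, 'n) ring_scheme \<Rightarrow> ('b \<Rightarrow> 'a) \<Rightarrow> bool"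
  where "formally_smooth B A \<phi> \<longleftrightarrow>
    (\<forall>C :: ('a + 'b) list list ring. cring C \<longrightarrow> infinitesimal_lifting B A \<phi> C)"

definition smooth_algebra ::
    "('b, 'm) ring_scheme \<Rightarrow> ('a, 'n) ring_scheme \<Rightarrow> ('b \<Rightarrow> 'a) \<Rightarrow> bool"
  where "smooth_algebra B A \<phi> \<longleftrightarrow>
    ring_hom_cring B A \<phi> \<and> finitely_presented B A \<phi> \<and> formally_smooth B A \<phi>"


subsection \<open>Independence of the type of the test rings\<close>

context cring
begin

definition eval_word :: "('g \<Rightarrow> 'a) \<Rightarrow> 'g list \<Rightarrow> 'a"
  where "eval_word g w = foldr (\<lambda>x y. g x \<otimes> y) w \<one>"

definition eval_words :: "('g \<Rightarrow> 'a) \<Rightarrow> 'g list list \<Rightarrow> 'a"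
  where "eval_words g ws = foldr (\<lambda>w y. eval_word g w \<oplus> y) ws \<zero>"

context
  fixes g :: "'g \<Rightarrow> 'a"
  assumes g: "\<And>x. g x \<in> carrier R"
begin

lemma eval_word_simps [simp]:
  "eval_word g [] = \<one>" "eval_word g (x # w) = g x \<otimes> eval_word g w"
  "eval_words g [] = \<zero>" "eval_words g (w # ws) = eval_word g w \<oplus> eval_words g ws"
  by (simp_all add: eval_word_def eval_words_def)

lemma eval_word_closed [simp]: "eval_word g w \<in> carrier R"
  by (induction w) (simp_all add: g)

lemma eval_words_closed [simp]: "eval_words g ws \<in> carrier R"
  by (induction ws) simp_all

lemma eval_word_append: "eval_word g (v @ w) = eval_word g v \<otimes> eval_word g w"
  by (induction v) (simp_all add: g m_assoc)

lemma eval_words_append: "eval_words g (vs @ ws) = eval_words g vs \<oplus> eval_words g ws"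
  by (induction vs) (simp_all add: a_assoc)

lemma eval_words_map_append: "eval_words g (map ((@) v) ws) = eval_word g v \<otimes> eval_words g ws"
  by (induction ws) (simp_all add: eval_word_append r_distr)

lemma eval_words_mult:
  "eval_words g (concat (map (\<lambda>v. map ((@) v) ws) vs)) = eval_words g vs \<otimes> eval_words g ws"
  by (induction vs) (simp_all add: eval_words_append eval_words_map_append l_distr)

lemma subring_range_eval_words:
  assumes "g m = \<ominus> \<one>"
  shows "subring (range (eval_words g)) R"
proof (rule subringI)
  show "range (eval_words g) \<subseteq> carrier R" by auto
  have "\<one> = eval_words g [[]]" by simp
  then show "\<one> \<in> range (eval_words g)" by blast
  fix x y assume "x \<in> range (eval_words g)" "y \<in> range (eval_words g)"
  then obtain vs ws where x: "x = eval_words g vs" and y: "y = eval_words g ws" by auto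
  have "\<ominus> x = eval_words g (map ((@) [m]) vs)"
    unfolding eval_words_map_append by (simp add: x assms l_minus)
  then show "\<ominus> x \<in> range (eval_words g)" by blast
  show "x \<otimes> y \<in> range (eval_words g)"
    unfolding x y eval_words_mult[symmetric] by blast
  show "x \<oplus> y \<in> range (eval_words g)"
    unfolding x y eval_words_append[symmetric] by blast
qed

lemma generator_in_range: "g x \<in> range (eval_words g)"
proof -
  have "g x = eval_words g [[x]]" by (simp add: g)
  then show ?thesis by blast
qed

end

end

lemma formally_smooth_lifting:
  fixes B :: "('b, 'm) ring_scheme" and A :: "('a, 'n) ring_scheme" and C :: "'c ring"
  assumes alg: "ring_hom_cring B A \<phi>" and fs: "formally_smooth B A \<phi>" and C: "cring C"
  shows "infinitesimal_lifting B A \<phi> C"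
  unfolding infinitesimal_lifting_def
proof (intro allI impI, elim conjE)
  fix \<psi> J u
  assume psi: "ring_hom_cring B C \<psi>" and J: "ideal J C"
    and sq: "\<forall>x \<in> J. \<forall>y \<in> J. x \<otimes>\<^bsub>C\<^esub> y = \<zero>\<^bsub>C\<^esub>"
    and u: "u \<in> ring_hom A (C Quot J)"
    and uphi: "\<forall>r \<in> carrier B. u (\<phi> r) = J +>\<^bsub>C\<^esub> \<psi> r"
  interpret phi: ring_hom_cring B A \<phi> by (rule alg)
  interpret psi: ring_hom_cring B C \<psi> by (rule psi)
  interpret J: ideal J C by (rule J)
  let ?D = "C Quot J"
  have coset_eq: "J +>\<^bsub>C\<^esub> x = J +>\<^bsub>C\<^esub> y \<longleftrightarrow> x \<ominus>\<^bsub>C\<^esub> y \<in> J"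
    if "x \<in> carrier C" "y \<in> carrier C" for x y
    using psi.S.quotient_eq_iff_same_a_r_cos[OF J that] by blast
  have coset_mult: "(J +>\<^bsub>C\<^esub> x) \<otimes>\<^bsub>?D\<^esub> (J +>\<^bsub>C\<^esub> y) = J +>\<^bsub>C\<^esub> (x \<otimes>\<^bsub>C\<^esub> y)"
    and coset_add: "(J +>\<^bsub>C\<^esub> x) \<oplus>\<^bsub>?D\<^esub> (J +>\<^bsub>C\<^esub> y) = J +>\<^bsub>C\<^esub> (x \<oplus>\<^bsub>C\<^esub> y)"
    if "x \<in> carrier C" "y \<in> carrier C" for x y
    using that ring_hom_mult[OF J.rcos_ring_hom] ring_hom_add[OF J.rcos_ring_hom] by simp_all
  have "\<exists>c. c \<in> carrier C \<and> u x = J +>\<^bsub>C\<^esub> c" if "x \<in> carrier A" for x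
    using ring_hom_closed[OF u that] by (auto simp: FactRing_def A_RCOSETS_def')
  then obtain l where l: "\<And>x. x \<in> carrier A \<Longrightarrow> l x \<in> carrier C"
    and lu: "\<And>x. x \<in> carrier A \<Longrightarrow> u x = J +>\<^bsub>C\<^esub> l x"
    by metis
  define g where "g = case_sum (\<lambda>x. if x \<in> carrier A then l x else \<one>\<^bsub>C\<^esub>)
                               (\<lambda>r. if r \<in> carrier B then \<psi> r else \<one>\<^bsub>C\<^esub>)"
  have g: "g x \<in> carrier C" for x
    by (cases x) (auto simp: g_def l)
  define ev where "ev = cring.eval_words C g"
  define S where "S = range ev"
  have "g (Inr (\<ominus>\<^bsub>B\<^esub> \<one>\<^bsub>B\<^esub>)) = \<ominus>\<^bsub>C\<^esub> \<one>\<^bsub>C\<^esub>"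
    by (simp add: g_def)
  then have S: "subring S C"
    unfolding S_def ev_def by (rule psi.S.subring_range_eval_words[OF g])
  have gS: "g x \<in> S" for x
    unfolding S_def ev_def by (rule psi.S.generator_in_range[OF g])
  have lS: "l x \<in> S" if "x \<in> carrier A" for x
    using gS[of "Inl x"] that by (simp add: g_def)
  have psiS: "\<psi> r \<in> S" if "r \<in> carrier B" for r
    using gS[of "Inr r"] that by (simp add: g_def)
  note SC = subringE(1)[OF S, THEN subsetD]
  note S_cl = subringE(2,3,5,6,7)[OF S]
  define enc where "enc = inv_into UNIV ev"
  have ev_enc [simp]: "ev (enc x) = x" if "x \<in> S" for x
    using that unfolding enc_def S_def by (rule f_inv_into_f)
  define C' where "C' = \<lparr> carrier = enc ` S, monoid.mult = (\<lambda>x y. enc (ev x \<otimes>\<^bsub>C\<^esub> ev y)),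
      one = enc \<one>\<^bsub>C\<^esub>, ring.zero = enc \<zero>\<^bsub>C\<^esub>, ring.add = (\<lambda>x y. enc (ev x \<oplus>\<^bsub>C\<^esub> ev y)) \<rparr>"
  have C'_simps [simp]: "carrier C' = enc ` S" "\<one>\<^bsub>C'\<^esub> = enc \<one>\<^bsub>C\<^esub>" "\<zero>\<^bsub>C'\<^esub> = enc \<zero>\<^bsub>C\<^esub>"
    "x \<otimes>\<^bsub>C'\<^esub> y = enc (ev x \<otimes>\<^bsub>C\<^esub> ev y)" "x \<oplus>\<^bsub>C'\<^esub> y = enc (ev x \<oplus>\<^bsub>C\<^esub> ev y)" for x y
    by (simp_all add: C'_def)
  have "cring C'"
  proof (rule cringI)
    show "abelian_group C'"
    proof (rule abelian_groupI)
      fix x assume "x \<in> carrier C'"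
      then obtain s where s: "s \<in> S" "x = enc s" by auto
      have "enc (\<ominus>\<^bsub>C\<^esub> s) \<oplus>\<^bsub>C'\<^esub> x = \<zero>\<^bsub>C'\<^esub>"
        using s S_cl SC by (simp add: psi.S.l_neg)
      then show "\<exists>y \<in> carrier C'. y \<oplus>\<^bsub>C'\<^esub> x = \<zero>\<^bsub>C'\<^esub>"
        using s S_cl by auto
    qed (use S_cl SC in \<open>auto simp: psi.S.a_ac\<close>)
    show "comm_monoid C'"
      by (rule comm_monoidI) (use S_cl SC in \<open>auto simp: psi.S.m_ac\<close>)
  qed (use S_cl SC in \<open>auto simp: psi.S.l_distr\<close>)
  then interpret C': cring C' .
  have evC [simp]: "ev x \<in> carrier C" "ev x \<in> S" for x
    using SC by (auto simp: S_def)
  have ev_hom: "ev \<in> ring_hom C' C"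
    by (rule ring_hom_memI) (use S_cl SC in auto)
  interpret ev: ring_hom_cring C' C ev
    by (rule ring_hom_cringI) (use ev_hom psi.S.ring_axioms C'.cring_axioms psi.S.cring_axioms
        C'.ring_axioms in \<open>auto intro: ring_hom_ringI2\<close>)
  have ev_minus: "ev (x \<ominus>\<^bsub>C'\<^esub> y) = ev x \<ominus>\<^bsub>C\<^esub> ev y" if "x \<in> carrier C'" "y \<in> carrier C'" for x y
    using that unfolding a_minus_def by (simp del: C'_simps)
  have enc_cl [simp]: "enc x \<in> carrier C'" if "x \<in> S" for x
    using that by simp
  define J' where "J' = {x \<in> carrier C'. ev x \<in> J}"
  have J': "ideal J' C'"
  proof (rule idealI)
    show "ring C'" by (rule C'.ring_axioms)
    show "subgroup J' (add_monoid C')"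
    proof (rule C'.add.subgroupI)
      show "J' \<subseteq> carrier C'" by (auto simp: J'_def)
      have "\<zero>\<^bsub>C'\<^esub> \<in> J'"
        unfolding J'_def using C'.zero_closed ev.hom_zero J.zero_closed by (simp del: C'_simps)
      then show "J' \<noteq> {}" by blast
      show "\<ominus>\<^bsub>C'\<^esub> x \<in> J'" if "x \<in> J'" for x
        using that J.a_inv_closed by (simp add: J'_def del: C'_simps)
      show "x \<oplus>\<^bsub>C'\<^esub> y \<in> J'" if "x \<in> J'" "y \<in> J'" for x y
        using that J.a_closed by (simp add: J'_def del: C'_simps)
    qed
    show "x \<otimes>\<^bsub>C'\<^esub> a \<in> J'" "a \<otimes>\<^bsub>C'\<^esub> x \<in> J'" if "a \<in> J'" "x \<in> carrier C'" for a x
      using that J.I_l_closed J.I_r_closed by (simp_all add: J'_def del: C'_simps)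
  qed
  interpret J': ideal J' C' by (rule J')
  let ?D' = "C' Quot J'"
  have coset'_eq: "J' +>\<^bsub>C'\<^esub> x = J' +>\<^bsub>C'\<^esub> y \<longleftrightarrow> J +>\<^bsub>C\<^esub> ev x = J +>\<^bsub>C\<^esub> ev y"
    if "x \<in> carrier C'" "y \<in> carrier C'" for x y
  proof -
    have "J' +>\<^bsub>C'\<^esub> x = J' +>\<^bsub>C'\<^esub> y \<longleftrightarrow> x \<ominus>\<^bsub>C'\<^esub> y \<in> J'"
      using C'.quotient_eq_iff_same_a_r_cos[OF J' that] by blast
    also have "\<dots> \<longleftrightarrow> ev x \<ominus>\<^bsub>C\<^esub> ev y \<in> J"
      unfolding J'_def using that C'.minus_closed[OF that] by (simp add: ev_minus del: C'_simps)
    finally show ?thesis by (simp add: coset_eq)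
  qed
  have hom': "ring_hom_cring B C' (\<lambda>r. enc (\<psi> r))"
  proof (rule ring_hom_cringI)
    show "(\<lambda>r. enc (\<psi> r)) \<in> ring_hom B C'"
      by (rule ring_hom_memI) (use psiS in auto)
  qed (rule phi.R.cring_axioms C'.cring_axioms)+
  have sq': "\<forall>x \<in> J'. \<forall>y \<in> J'. x \<otimes>\<^bsub>C'\<^esub> y = \<zero>\<^bsub>C'\<^esub>"
    using sq by (auto simp: J'_def)
  define u' where "u' = (\<lambda>x. J' +>\<^bsub>C'\<^esub> enc (l x))"
  have u'I: "J' +>\<^bsub>C'\<^esub> enc (l x) = J' +>\<^bsub>C'\<^esub> y" if "x \<in> carrier A" "y \<in> carrier C'" "u x = J +>\<^bsub>C\<^esub> ev y" for x y
    using that lS lu by (simp add: coset'_eq del: C'_simps)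
  have u': "u' \<in> ring_hom A ?D'"
  proof (rule ring_hom_memI)
    fix x y assume xy: "x \<in> carrier A" "y \<in> carrier A"
    show "u' x \<in> carrier ?D'"
      using ring_hom_closed[OF J'.rcos_ring_hom enc_cl[OF lS[OF xy(1)]]] by (simp add: u'_def)
    have e: "enc (l x) \<in> carrier C'" "enc (l y) \<in> carrier C'" 
      using xy lS enc_cl by blast+
    show "u' (x \<otimes>\<^bsub>A\<^esub> y) = u' x \<otimes>\<^bsub>?D'\<^esub> u' y"
      unfolding u'_def ring_hom_mult[OF J'.rcos_ring_hom e, symmetric]
      using xy e lS l ring_hom_mult[OF u xy]
      by (intro u'I) (simp_all add: lu coset_mult del: C'_simps)
    show "u' (x \<oplus>\<^bsub>A\<^esub> y) = u' x \<oplus>\<^bsub>?D'\<^esub> u' y"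
      unfolding u'_def ring_hom_add[OF J'.rcos_ring_hom e, symmetric]
      using xy e lS l ring_hom_add[OF u xy]
      by (intro u'I) (simp_all add: lu coset_add del: C'_simps)
  next
    show "u' \<one>\<^bsub>A\<^esub> = \<one>\<^bsub>?D'\<^esub>"
      unfolding u'_def ring_hom_one[OF J'.rcos_ring_hom, symmetric]
      using ring_hom_one[OF u] ring_hom_one[OF J.rcos_ring_hom]
      by (intro u'I) (simp_all del: C'_simps)
  qed
  have u'phi: "\<forall>r \<in> carrier B. u' (\<phi> r) = J' +>\<^bsub>C'\<^esub> enc (\<psi> r)"
    unfolding u'_def
  proof
    fix r assume r: "r \<in> carrier B"
    show "J' +>\<^bsub>C'\<^esub> enc (l (\<phi> r)) = J' +>\<^bsub>C'\<^esub> enc (\<psi> r)"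
      by (rule u'I) (use r uphi psiS in simp_all)
  qed
  have "infinitesimal_lifting B A \<phi> C'"
    using fs C'.cring_axioms unfolding formally_smooth_def by blast
  then obtain v' where v': "v' \<in> ring_hom A C'"
    and v'phi: "\<forall>r \<in> carrier B. v' (\<phi> r) = enc (\<psi> r)"
    and v'u: "\<forall>x \<in> carrier A. J' +>\<^bsub>C'\<^esub> v' x = u' x"
    unfolding infinitesimal_lifting_def using hom' J' sq' u' u'phi by blast
  show "\<exists>v \<in> ring_hom A C. (\<forall>r \<in> carrier B. v (\<phi> r) = \<psi> r) \<and>
      (\<forall>x \<in> carrier A. J +>\<^bsub>C\<^esub> v x = u x)"
  proof (intro bexI conjI ballI)
    show "ev \<circ> v' \<in> ring_hom A C"
      using v' ev_hom by (rule ring_hom_trans)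
    show "(ev \<circ> v') (\<phi> r) = \<psi> r" if "r \<in> carrier B" for r
      using that v'phi psiS by simp
    show "J +>\<^bsub>C\<^esub> (ev \<circ> v') x = u x" if "x \<in> carrier A" for x
    proof -
      have "J' +>\<^bsub>C'\<^esub> v' x = J' +>\<^bsub>C'\<^esub> enc (l x)"
        using v'u that by (simp add: u'_def)
      then show ?thesis
        using that lS lu ring_hom_closed[OF v' that] by (simp add: coset'_eq del: C'_simps)
    qed
  qed
qed


section \<open>The algebra \<open>B[X,Y]/(aX\<^sup>2 + bXY + cY\<^sup>2 - 1)\<close>\<close>

text \<open>\<open>X\<close> and \<open>Y\<close> are \<open>x\<close> and \<open>y\<close> below, the variables with indices \<open>0\<close> and \<open>1\<close> of \<open>B[X\<^sub>0, X\<^sub>1]\<close>.\<close>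

definition quadric_poly :: "('b, 'm) ring_scheme \<Rightarrow> 'b \<Rightarrow> 'b \<Rightarrow> 'b \<Rightarrow> (nat multiset \<Rightarrow> 'b)"
  where "quadric_poly B a b c =
    (let P = indexed_poly_ring B {0, 1};
         x = ring.indexed_var B 0;
         y = ring.indexed_var B 1;
         C = ring.indexed_const B
     in C a \<otimes>\<^bsub>P\<^esub> x [^]\<^bsub>P\<^esub> (2::nat) \<oplus>\<^bsub>P\<^esub> C b \<otimes>\<^bsub>P\<^esub> x \<otimes>\<^bsub>P\<^esub> y
          \<oplus>\<^bsub>P\<^esub> C c \<otimes>\<^bsub>P\<^esub> y [^]\<^bsub>P\<^esub> (2::nat) \<ominus>\<^bsub>P\<^esub> \<one>\<^bsub>P\<^esub>)"

definition quadric_ideal :: "('b, 'm) ring_scheme \<Rightarrow> 'b \<Rightarrow> 'b \<Rightarrow> 'b \<Rightarrow> (nat multiset \<Rightarrow> 'b) set"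
  where "quadric_ideal B a b c = Idl\<^bsub>indexed_poly_ring B {0, 1}\<^esub> {quadric_poly B a b c}"

definition quadric_algebra ::
    "('b, 'm) ring_scheme \<Rightarrow> 'b \<Rightarrow> 'b \<Rightarrow> 'b \<Rightarrow> (nat multiset \<Rightarrow> 'b) set ring"
  where "quadric_algebra B a b c = indexed_poly_ring B {0, 1} Quot quadric_ideal B a b c"

definition quadric_structure_map ::
    "('b, 'm) ring_scheme \<Rightarrow> 'b \<Rightarrow> 'b \<Rightarrow> 'b \<Rightarrow> 'b \<Rightarrow> (nat multiset \<Rightarrow> 'b) set"
  where "quadric_structure_map B a b c r =
    quadric_ideal B a b c +>\<^bsub>indexed_poly_ring B {0, 1}\<^esub> ring.indexed_const B r"


section \<open>Radicals\<close>

definition radical_ideal :: "('b, 'm) ring_scheme \<Rightarrow> 'b set \<Rightarrow> 'b set"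
  where "radical_ideal R I = {x \<in> carrier R. \<exists>n::nat. x [^]\<^bsub>R\<^esub> n \<in> I}"

end

theory Submission
  imports Defs
begin

text \<open>Put \<open>q = aX\<^sup>2 + bXY + cY\<^sup>2\<close>. Lifting a homomorphism \<open>A \<rightarrow> C/J\<close> to \<open>C\<close> means moving a point
  \<open>(x, y)\<close> with \<open>q(x, y) = 1 + \<epsilon>\<close>, \<open>\<epsilon> \<in> J\<close>, by elements of \<open>J\<close> onto the curve \<open>q = 1\<close>; since
  \<open>J\<^sup>2 = 0\<close> this is one Newton step, which succeeds as soon as \<open>\<epsilon>\<close> is a combination of the partial
  derivatives of \<open>q\<close> at \<open>(x, y)\<close> with coefficients in \<open>J\<close>. The \<open>z\<close> for which \<open>\<epsilon>z\<close> is such a combination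
  form an ideal, and Euler's formula puts \<open>2\<close>, and then \<open>b\<close>, into it. If \<open>a\<close> and \<open>c\<close> are nilpotent modulo
  \<open>(2, b)\<close>, then so is \<open>q(x, y)\<close>, by Frobenius; as \<open>\<epsilon>(1 + \<epsilon>)\<^sup>n = \<epsilon>\<close>, the ideal acts on \<open>\<epsilon>\<close> like the unit ideal.

  Conversely, let \<open>Q = B/(2, b)\<close> and \<open>C = Q[T]/((aT\<^sup>2 - 1)\<^sup>2)\<close>, with the point \<open>(T, 0)\<close> modulo
  \<open>aT\<^sup>2 - 1\<close>. The derivatives of \<open>q\<close> vanish in \<open>C\<close>, so a lift can only exist if \<open>aT\<^sup>2 - 1\<close> is already \<open>0\<close>
  in \<open>C\<close>. Then \<open>aT\<^sup>2 - 1\<close> is a unit of \<open>Q[T]\<close>, whose inverse \<open>-(1 + aT\<^sup>2 + a\<^sup>2T\<^sup>4 + \<dots>)\<close> has to be finite, so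
  \<open>a\<close> is nilpotent in \<open>Q\<close>. The point \<open>(0, T)\<close> does the same for \<open>c\<close>.\<close>

section \<open>Polynomial rings in several variables\<close>

lemma finite_submultisets: "finite {k. k \<subseteq># m}"
proof (induction m)
  case (add x m)
  have "{k. k \<subseteq># add_mset x m} \<subseteq> {k. k \<subseteq># m} \<union> add_mset x ` {k. k \<subseteq># m}"
  proof
    fix k assume k: "k \<in> {k. k \<subseteq># add_mset x m}"
    show "k \<in> {k. k \<subseteq># m} \<union> add_mset x ` {k. k \<subseteq># m}"
    proof (cases "x \<in># k")
      case True
      then obtain k' where "k = add_mset x k'" by (metis insert_DiffM)
      then show ?thesis using k by auto
    next
      case False
      then show ?thesis using k
        by (auto simp: subseteq_mset_def not_in_iff split: if_splits) (metis le0)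
    qed
  qed
  then show ?case using add.IH by (meson finite_UnI finite_imageI finite_subset)
qed simp

context cring
begin

text \<open>This is the product of \<open>indexed_poly_ring\<close>, made available for all
  coefficient functions, before closure of \<open>indexed_pset\<close> under it is known.\<close>

definition convolution :: "('i multiset \<Rightarrow> 'a) \<Rightarrow> ('i multiset \<Rightarrow> 'a) \<Rightarrow> 'i multiset \<Rightarrow> 'a"
  where "convolution p q = (\<lambda>m. finsum R (\<lambda>k. p k \<otimes> q (m - k)) {k. k \<subseteq># m})"

lemma convolution_carrier_coeff:
  assumes "carrier_coeff p" "carrier_coeff q"
  shows "carrier_coeff (convolution p q)"
  using assms by (simp add: carrier_coeff_def convolution_def)

text \<open>Only the summand with \<open>k = {#}\<close> survives. This rule and the next two follow
  the constructors of \<open>indexed_pset\<close>, so that properties of the product can be proved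
  by induction on the left factor.\<close>

lemma convolution_const:
  assumes "r \<in> carrier R" "carrier_coeff q"
  shows "convolution (indexed_const r) q = (\<lambda>m. r \<otimes> q m)"
proof
  fix m
  have q: "q k \<in> carrier R" for k using assms(2) by (rule carrier_coeffE)
  have "convolution (indexed_const r) q m =
      finsum R (\<lambda>k. if k = {#} then r \<otimes> q (m - k) else \<zero>) {k. k \<subseteq># m}"
    unfolding convolution_def by (rule finsum_cong') (use assms(1) q in \<open>auto simp: indexed_const_def\<close>)
  also have "\<dots> = r \<otimes> q (m - {#})"
    by (rule add.finprod_singleton_swap) (use assms(1) q finite_submultisets in auto)
  finally show "convolution (indexed_const r) q m = r \<otimes> q m" by simp
qed

lemma convolution_padd:
  assumes "carrier_coeff p1" "carrier_coeff p2" "carrier_coeff q"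
  shows "convolution (indexed_padd p1 p2) q = indexed_padd (convolution p1 q) (convolution p2 q)"
  using assms[THEN carrier_coeffE] by (simp add: convolution_def indexed_padd_def l_distr finsum_addf Pi_def)

text \<open>Adding \<open>i\<close> is a bijection from the submultisets of \<open>m'\<close> onto
  those submultisets of \<open>add_mset i m'\<close> that contain \<open>i\<close>; on all others
  \<open>indexed_pmult p i\<close> vanishes.\<close>

lemma convolution_pmult:
  assumes "carrier_coeff p" "carrier_coeff q"
  shows "convolution (indexed_pmult p i) q = indexed_pmult (convolution p q) i"
proof
  fix m
  have [simp]: "p k \<in> carrier R" "q k \<in> carrier R" for k using assms by (auto dest: carrier_coeffE)
  show "convolution (indexed_pmult p i) q m = indexed_pmult (convolution p q) i m"
  proof (cases "i \<in># m")
    case True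
    then obtain m' where m: "m = add_mset i m'" by (metis insert_DiffM)
    have "convolution (indexed_pmult p i) q m =
        finsum R (\<lambda>k. indexed_pmult p i k \<otimes> q (m - k)) (add_mset i ` {k. k \<subseteq># m'})"
      unfolding convolution_def
    proof (rule add.finprod_mono_neutral_cong_right)
      show "finite {k. k \<subseteq># m}" by (rule finite_submultisets)
      show "add_mset i ` {k. k \<subseteq># m'} \<subseteq> {k. k \<subseteq># m}" by (auto simp: m)
      fix k assume k: "k \<in> {k. k \<subseteq># m} - add_mset i ` {k. k \<subseteq># m'}"
      have "i \<notin># k"
      proof
        assume "i \<in># k"
        then obtain k' where "k = add_mset i k'" by (metis insert_DiffM)
        then show False using k by (auto simp: m)
      qed
      then show "indexed_pmult p i k \<otimes> q (m - k) = \<zero>"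
        by (simp add: indexed_pmult_def)
    qed (auto simp: indexed_pmult_def)
    also have "\<dots> = finsum R (\<lambda>k. indexed_pmult p i (add_mset i k) \<otimes> q (m - add_mset i k)) {k. k \<subseteq># m'}"
      by (rule finsum_reindex) (auto simp: indexed_pmult_def inj_on_def)
    finally show ?thesis by (simp add: indexed_pmult_def convolution_def m)
  next
    case False
    then have "(if i \<in># k then p (k - {#i#}) else \<zero>) \<otimes> q (m - k) = \<zero>" if "k \<subseteq># m" for k
      using that by (auto dest: mset_subset_eqD)
    then show ?thesis using False
      by (simp add: convolution_def indexed_pmult_def) (rule add.finprod_one_eqI, simp)
  qed
qed

text \<open>The sum is reindexed by complementation in \<open>m\<close>, an involution on the
  submultisets of \<open>m\<close>.\<close>

lemma convolution_commute:
  fixes p q :: "'i multiset \<Rightarrow> 'a"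
  assumes "carrier_coeff p" "carrier_coeff q"
  shows "convolution p q = convolution q p"
proof
  fix m :: "'i multiset"
  have [simp]: "p k \<in> carrier R" "q k \<in> carrier R" for k using assms by (auto dest: carrier_coeffE)
  have diff_diff: "m - (m - k) = k" if "k \<subseteq># m" for k
    using that by (intro multiset_eqI) (simp add: subseteq_mset_def)
  have im: "(-) m ` {k. k \<subseteq># m} = {k. k \<subseteq># m}"
  proof (intro equalityI subsetI)
    fix k assume "k \<in> {k. k \<subseteq># m}"
    then have "k = m - (m - k)" "m - k \<in> {k. k \<subseteq># m}"
      by (simp_all add: diff_diff)
    then show "k \<in> (-) m ` {k. k \<subseteq># m}" by blast
  qed auto
  have inj: "inj_on ((-) m) {k. k \<subseteq># m}"
    by (rule inj_on_inverseI[where g = "(-) m"]) (simp add: diff_diff)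
  have "convolution p q m = finsum R (\<lambda>k. p k \<otimes> q (m - k)) ((-) m ` {k. k \<subseteq># m})"
    by (simp only: im convolution_def)
  also have "\<dots> = finsum R (\<lambda>k. p (m - k) \<otimes> q (m - (m - k))) {k. k \<subseteq># m}"
    by (rule finsum_reindex[OF _ inj]) auto
  also have "\<dots> = convolution q p m"
    unfolding convolution_def by (rule finsum_cong') (auto simp: m_comm diff_diff)
  finally show "convolution p q m = convolution q p m" .
qed

context
  fixes I :: "'i set"
begin

lemma indexed_poly_ring_simps [simp]:
  "carrier (indexed_poly_ring R I) = indexed_pset I (carrier R)"
  "p \<otimes>\<^bsub>indexed_poly_ring R I\<^esub> q = convolution p q"
  "\<one>\<^bsub>indexed_poly_ring R I\<^esub> = indexed_const \<one>"
  "\<zero>\<^bsub>indexed_poly_ring R I\<^esub> = indexed_const \<zero>"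
  "p \<oplus>\<^bsub>indexed_poly_ring R I\<^esub> q = indexed_padd p q"
  by (simp_all add: indexed_poly_ring_def convolution_def)

lemma indexed_pset_coeff: "p \<in> indexed_pset I (carrier R) \<Longrightarrow> carrier_coeff p"
  by (rule indexed_pset_in_carrier) auto

text \<open>This is the constant case of closure under products; with
  \<open>r = \<ominus> \<one>\<close> it also supplies the additive inverses.\<close>

lemma indexed_pset_smult:
  assumes "r \<in> carrier R" "q \<in> indexed_pset I (carrier R)"
  shows "(\<lambda>m. r \<otimes> q m) \<in> indexed_pset I (carrier R)"
  using assms(2)
proof induction
  case (indexed_const k)
  have "(\<lambda>m :: 'i multiset. r \<otimes> indexed_const k m) = indexed_const (r \<otimes> k)"
    using assms(1) by (auto simp: indexed_const_def)
  then show ?case using assms(1) indexed_const by (simp add: indexed_pset.indexed_const)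
next
  case (indexed_padd p q)
  have "(\<lambda>m. r \<otimes> indexed_padd p q m) = indexed_padd (\<lambda>m. r \<otimes> p m) (\<lambda>m. r \<otimes> q m)"
    using assms(1) indexed_padd.hyps[THEN indexed_pset_coeff, THEN carrier_coeffE]
    by (auto simp: indexed_padd_def r_distr)
  then show ?case using indexed_padd.IH by (simp add: indexed_pset.indexed_padd)
next
  case (indexed_pmult p i)
  have "(\<lambda>m. r \<otimes> indexed_pmult p i m) = indexed_pmult (\<lambda>m. r \<otimes> p m) i"
    using assms(1) by (auto simp: indexed_pmult_def)
  then show ?case using indexed_pmult by (simp add: indexed_pset.indexed_pmult)
qed

lemma convolution_closed:
  assumes "p \<in> indexed_pset I (carrier R)" "q \<in> indexed_pset I (carrier R)"
  shows "convolution p q \<in> indexed_pset I (carrier R)"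
  using assms(1)
  by induction (simp_all add: convolution_const convolution_padd convolution_pmult
      indexed_pset_coeff assms(2) indexed_pset_smult indexed_pset.intros)

lemma convolution_assoc:
  assumes "p \<in> indexed_pset I (carrier R)" "q \<in> indexed_pset I (carrier R)" "r \<in> indexed_pset I (carrier R)"
  shows "convolution (convolution p q) r = convolution p (convolution q r)"
  using assms(1)
proof induction
  case (indexed_const k)
  note C = assms(2,3)[THEN indexed_pset_coeff] convolution_carrier_coeff[OF assms(2,3)[THEN indexed_pset_coeff]]
  show ?case
    using indexed_const C C(1,2)[THEN carrier_coeffE]
    by (simp add: convolution_const) (simp add: convolution_def m_assoc finsum_rdistr finite_submultisets Pi_def)
qed (simp_all add: convolution_padd convolution_pmult indexed_pset_coeff convolution_carrier_coeff assms)

lemma indexed_poly_cring: "cring (indexed_poly_ring R I)"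
proof (rule cringI)
  note C = indexed_pset_coeff carrier_coeffE[OF indexed_pset_coeff]
  show "abelian_group (indexed_poly_ring R I)"
  proof (rule abelian_groupI)
    show "\<zero>\<^bsub>indexed_poly_ring R I\<^esub> \<in> carrier (indexed_poly_ring R I)" by (simp add: indexed_pset.intros)
  next
    fix p assume p: "p \<in> carrier (indexed_poly_ring R I)"
    then have "indexed_padd (\<lambda>m. (\<ominus> \<one>) \<otimes> p m) p = indexed_const \<zero>"
      by (auto simp: indexed_padd_def indexed_zero_def C l_minus l_neg)
    then show "\<exists>q\<in>carrier (indexed_poly_ring R I). q \<oplus>\<^bsub>indexed_poly_ring R I\<^esub> p = \<zero>\<^bsub>indexed_poly_ring R I\<^esub>"
      using p indexed_pset_smult[of "\<ominus> \<one>" p] by auto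
    show "\<zero>\<^bsub>indexed_poly_ring R I\<^esub> \<oplus>\<^bsub>indexed_poly_ring R I\<^esub> p = p"
      using p by (simp add: indexed_padd_zero C)
  next
    fix p q assume p: "p \<in> carrier (indexed_poly_ring R I)" and q: "q \<in> carrier (indexed_poly_ring R I)"
    then show "p \<oplus>\<^bsub>indexed_poly_ring R I\<^esub> q \<in> carrier (indexed_poly_ring R I)" by (simp add: indexed_pset.intros)
    show "p \<oplus>\<^bsub>indexed_poly_ring R I\<^esub> q = q \<oplus>\<^bsub>indexed_poly_ring R I\<^esub> p"
      using p q by (auto simp: indexed_padd_def C a_comm)
    fix r assume "r \<in> carrier (indexed_poly_ring R I)"
    then show "p \<oplus>\<^bsub>indexed_poly_ring R I\<^esub> q \<oplus>\<^bsub>indexed_poly_ring R I\<^esub> r = p \<oplus>\<^bsub>indexed_poly_ring R I\<^esub> (q \<oplus>\<^bsub>indexed_poly_ring R I\<^esub> r)"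
      using p q by (auto simp: indexed_padd_def C a_assoc)
  qed
  show "comm_monoid (indexed_poly_ring R I)"
    by (rule comm_monoidI)
      (auto simp: convolution_closed indexed_pset.intros convolution_assoc convolution_const C
        intro: convolution_commute)
qed (simp add: convolution_padd indexed_pset_coeff)

end

end

section \<open>Homomorphisms out of quotients and polynomial rings\<close>

lemma (in ring_hom_ring) hom_factor_through_quotient:
  assumes I: "ideal I R" and 0: "\<And>x. x \<in> I \<Longrightarrow> h x = \<zero>\<^bsub>S\<^esub>"
  obtains v where "v \<in> ring_hom (R Quot I) S" "\<And>x. x \<in> carrier R \<Longrightarrow> v (I +>\<^bsub>R\<^esub> x) = h x"
proof
  interpret I: ideal I R by (rule I)
  \<comment> \<open>The value at a coset is that of \<open>h\<close> at a chosen representative; any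
    other choice differs by an element of \<open>I\<close>, which \<open>h\<close> kills.\<close>
  define v :: "'a set \<Rightarrow> 'c" where "v U = h (SOME x. x \<in> carrier R \<and> U = I +>\<^bsub>R\<^esub> x)" for U
  show v: "v (I +>\<^bsub>R\<^esub> x) = h x" if x: "x \<in> carrier R" for x
  proof -
    let ?y = "SOME y. y \<in> carrier R \<and> I +>\<^bsub>R\<^esub> x = I +>\<^bsub>R\<^esub> y"
    have y: "?y \<in> carrier R \<and> I +>\<^bsub>R\<^esub> x = I +>\<^bsub>R\<^esub> ?y" by (rule someI) (use x in simp)
    then have "x \<ominus> ?y \<in> I" using R.quotient_eq_iff_same_a_r_cos[OF I] x by blast
    then have "h x \<ominus>\<^bsub>S\<^esub> h ?y = \<zero>\<^bsub>S\<^esub>" using 0[of "x \<ominus> ?y"] x y by (simp add: a_minus_def)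
    then show ?thesis using x y by (simp add: v_def)
  qed
  have q: "\<exists>x \<in> carrier R. U = I +>\<^bsub>R\<^esub> x" if "U \<in> carrier (R Quot I)" for U
    using that by (auto simp: FactRing_def A_RCOSETS_def')
  note hom = I.rcos_ring_hom
  show "v \<in> ring_hom (R Quot I) S"
  proof (rule ring_hom_memI)
    fix U W assume "U \<in> carrier (R Quot I)" "W \<in> carrier (R Quot I)"
    then obtain x y where xy: "x \<in> carrier R" "y \<in> carrier R" and U: "U = I +>\<^bsub>R\<^esub> x" and W: "W = I +>\<^bsub>R\<^esub> y"
      using q by meson
    show "v U \<in> carrier S" by (simp add: U v xy)
    show "v (U \<otimes>\<^bsub>R Quot I\<^esub> W) = v U \<otimes>\<^bsub>S\<^esub> v W"
      unfolding U W ring_hom_mult[OF hom xy, symmetric] by (simp add: v xy)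
    show "v (U \<oplus>\<^bsub>R Quot I\<^esub> W) = v U \<oplus>\<^bsub>S\<^esub> v W"
      unfolding U W ring_hom_add[OF hom xy, symmetric] by (simp add: v xy)
  next
    show "v \<one>\<^bsub>R Quot I\<^esub> = \<one>\<^bsub>S\<^esub>"
      unfolding ring_hom_one[OF hom, symmetric] by (simp add: v)
  qed
qed

text \<open>A constant has at most one monomial, a sum lives on the union of two supports, and
  multiplication by a variable shifts the support. Evaluation below is a finite sum for this
  reason.\<close>

lemma (in ring) finite_support_indexed_pset:
  assumes "p \<in> indexed_pset I (carrier R)"
  shows "finite {m. p m \<noteq> \<zero>}"
  using assms
proof induction
  case (indexed_const k)
  have "{m. indexed_const k m \<noteq> \<zero>} \<subseteq> {{#}}" by (auto simp: indexed_const_def)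
  then show ?case by (rule finite_subset) simp
next
  case (indexed_padd p q)
  have "{m. indexed_padd p q m \<noteq> \<zero>} \<subseteq> {m. p m \<noteq> \<zero>} \<union> {m. q m \<noteq> \<zero>}"
    by (auto simp: indexed_padd_def)
  then show ?case by (rule finite_subset) (use indexed_padd.IH in simp)
next
  case (indexed_pmult p i)
  have "{m. indexed_pmult p i m \<noteq> \<zero>} \<subseteq> add_mset i ` {m. p m \<noteq> \<zero>}"
  proof
    fix m assume "m \<in> {m. indexed_pmult p i m \<noteq> \<zero>}"
    then have "m = add_mset i (m - {#i#})" "p (m - {#i#}) \<noteq> \<zero>"
      by (auto simp: indexed_pmult_def split: if_splits)
    then show "m \<in> add_mset i ` {m. p m \<noteq> \<zero>}" by blast
  qed
  then show ?case by (rule finite_subset) (use indexed_pmult.IH in simp)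
qed

context ring_hom_cring
begin

definition monomial_value :: "('i \<Rightarrow> 'c) \<Rightarrow> 'i set \<Rightarrow> 'i multiset \<Rightarrow> 'c"
  where "monomial_value x I m = finprod S (\<lambda>i. x i [^]\<^bsub>S\<^esub> count m i) I"

text \<open>A member of \<open>indexed_pset\<close> can be built in many ways, so recursion over the
  constructors would not be well defined; a sum over the support is.\<close>

definition poly_value :: "('i \<Rightarrow> 'c) \<Rightarrow> 'i set \<Rightarrow> ('i multiset \<Rightarrow> 'a) \<Rightarrow> 'c"
  where "poly_value x I p = finsum S (\<lambda>m. h (p m) \<otimes>\<^bsub>S\<^esub> monomial_value x I m) {m. p m \<noteq> \<zero>}"

context
  fixes x :: "'i \<Rightarrow> 'c" and I :: "'i set"
  assumes fin: "finite I" and x: "x \<in> I \<rightarrow> carrier S"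
begin

lemma monomial_value_closed [simp]: "monomial_value x I m \<in> carrier S"
  unfolding monomial_value_def by (rule S.finprod_closed) (use x in auto)

lemma monomial_value_empty: "monomial_value x I {#} = \<one>\<^bsub>S\<^esub>"
  by (simp add: monomial_value_def)

lemma monomial_value_add_mset:
  assumes "i \<in> I"
  shows "monomial_value x I (add_mset i m) = monomial_value x I m \<otimes>\<^bsub>S\<^esub> x i"
proof -
  have x': "x j \<in> carrier S" if "j \<in> I" for j using x that by auto
  have "monomial_value x I (add_mset i m) =
      finprod S (\<lambda>j. x j [^]\<^bsub>S\<^esub> count m j \<otimes>\<^bsub>S\<^esub> (if j = i then x j else \<one>\<^bsub>S\<^esub>)) I"
    unfolding monomial_value_def by (rule S.finprod_cong') (auto simp: x')
  also have "\<dots> = monomial_value x I m \<otimes>\<^bsub>S\<^esub> finprod S (\<lambda>j. if j = i then x j else \<one>\<^bsub>S\<^esub>) I"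
    unfolding monomial_value_def by (rule S.finprod_multf) (auto simp: x')
  also have "finprod S (\<lambda>j. if j = i then x j else \<one>\<^bsub>S\<^esub>) I = x i"
    by (rule S.finprod_singleton_swap[OF assms fin x])
  finally show ?thesis .
qed

text \<open>Monomials with coefficient zero contribute nothing, so polynomials with different
  supports can be evaluated over a common set of monomials.\<close>

lemma poly_value_eq_finsum:
  assumes "finite M" "{m. p m \<noteq> \<zero>} \<subseteq> M" "R.carrier_coeff p"
  shows "poly_value x I p = finsum S (\<lambda>m. h (p m) \<otimes>\<^bsub>S\<^esub> monomial_value x I m) M"
  unfolding poly_value_def
  by (rule S.add.finprod_mono_neutral_cong_left)
     (use assms in \<open>auto simp: R.carrier_coeff_def\<close>)

lemma poly_value_closed: "R.carrier_coeff p \<Longrightarrow> poly_value x I p \<in> carrier S"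
  unfolding poly_value_def by (rule S.finsum_closed) (auto simp: R.carrier_coeff_def)

lemma poly_value_const:
  assumes "r \<in> carrier R"
  shows "poly_value x I (R.indexed_const r) = h r"
proof -
  have "poly_value x I (R.indexed_const r) =
      finsum S (\<lambda>m. h (R.indexed_const r m) \<otimes>\<^bsub>S\<^esub> monomial_value x I m) {{#}}"
    by (rule poly_value_eq_finsum) (use assms in \<open>auto simp: R.indexed_const_def R.carrier_coeff_def\<close>)
  then show ?thesis using assms by (simp add: R.indexed_const_def monomial_value_empty)
qed

lemma poly_value_padd:
  assumes "p \<in> R.indexed_pset I (carrier R)" "q \<in> R.indexed_pset I (carrier R)"
  shows "poly_value x I (R.indexed_padd p q) = poly_value x I p \<oplus>\<^bsub>S\<^esub> poly_value x I q"
proof -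
  note C = assms[THEN R.indexed_pset_coeff]
  note C' = C[THEN R.carrier_coeffE]
  let ?M = "{m. p m \<noteq> \<zero>} \<union> {m. q m \<noteq> \<zero>}"
  have M: "finite ?M" using assms[THEN R.finite_support_indexed_pset] by simp
  have "poly_value x I (R.indexed_padd p q) =
      finsum S (\<lambda>m. h (R.indexed_padd p q m) \<otimes>\<^bsub>S\<^esub> monomial_value x I m) ?M"
    by (rule poly_value_eq_finsum[OF M _ R.indexed_padd_in_carrier[OF C]]) (auto simp: R.indexed_padd_def)
  also have "\<dots> = finsum S (\<lambda>m. h (p m) \<otimes>\<^bsub>S\<^esub> monomial_value x I m) ?M \<oplus>\<^bsub>S\<^esub>
      finsum S (\<lambda>m. h (q m) \<otimes>\<^bsub>S\<^esub> monomial_value x I m) ?M"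
    by (simp add: C' R.indexed_padd_def S.l_distr S.finsum_addf Pi_def)
  also have "\<dots> = poly_value x I p \<oplus>\<^bsub>S\<^esub> poly_value x I q"
    using poly_value_eq_finsum[OF M _ C(1)] poly_value_eq_finsum[OF M _ C(2)] by simp
  finally show ?thesis .
qed

lemma poly_value_smult:
  assumes "r \<in> carrier R" "q \<in> R.indexed_pset I (carrier R)"
  shows "poly_value x I (\<lambda>m. r \<otimes> q m) = h r \<otimes>\<^bsub>S\<^esub> poly_value x I q"
proof -
  note C = R.indexed_pset_coeff[OF assms(2)]
  note C' = R.carrier_coeffE[OF C]
  have M: "finite {m. q m \<noteq> \<zero>}" by (rule R.finite_support_indexed_pset[OF assms(2)])
  have "poly_value x I (\<lambda>m. r \<otimes> q m) =
      finsum S (\<lambda>m. h (r \<otimes> q m) \<otimes>\<^bsub>S\<^esub> monomial_value x I m) {m. q m \<noteq> \<zero>}"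
    by (rule poly_value_eq_finsum[OF M]) (use assms C' in \<open>auto simp: R.carrier_coeff_def\<close>)
  then show ?thesis
    unfolding poly_value_def by (simp add: assms C' S.m_assoc S.finsum_rdistr M Pi_def)
qed

lemma poly_value_pmult:
  assumes "p \<in> R.indexed_pset I (carrier R)" "i \<in> I"
  shows "poly_value x I (R.indexed_pmult p i) = poly_value x I p \<otimes>\<^bsub>S\<^esub> x i"
proof -
  note C = R.indexed_pset_coeff[OF assms(1)]
  note C' = R.carrier_coeffE[OF C]
  have M: "finite {m. p m \<noteq> \<zero>}" by (rule R.finite_support_indexed_pset[OF assms(1)])
  have xi: "x i \<in> carrier S" using x assms(2) by auto
  have "{m. R.indexed_pmult p i m \<noteq> \<zero>} \<subseteq> add_mset i ` {m. p m \<noteq> \<zero>}"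
  proof
    fix m assume "m \<in> {m. R.indexed_pmult p i m \<noteq> \<zero>}"
    then have "m = add_mset i (m - {#i#})" "p (m - {#i#}) \<noteq> \<zero>"
      by (auto simp: R.indexed_pmult_def split: if_splits)
    then show "m \<in> add_mset i ` {m. p m \<noteq> \<zero>}" by blast
  qed
  then have "poly_value x I (R.indexed_pmult p i) =
      finsum S (\<lambda>m. h (R.indexed_pmult p i m) \<otimes>\<^bsub>S\<^esub> monomial_value x I m) (add_mset i ` {m. p m \<noteq> \<zero>})"
    by (intro poly_value_eq_finsum R.indexed_pmult_in_carrier[OF C]) (use M in auto)
  also have "\<dots> = finsum S (\<lambda>m. h (R.indexed_pmult p i (add_mset i m)) \<otimes>\<^bsub>S\<^esub>
      monomial_value x I (add_mset i m)) {m. p m \<noteq> \<zero>}"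
    by (rule S.finsum_reindex) (auto simp: R.indexed_pmult_def C' inj_on_def)
  also have "\<dots> = poly_value x I p \<otimes>\<^bsub>S\<^esub> x i"
    unfolding poly_value_def
    by (simp add: R.indexed_pmult_def monomial_value_add_mset assms(2) xi C' M S.finsum_ldistr Pi_def S.m_assoc)
  finally show ?thesis .
qed

text \<open>Multiplicativity goes by induction on the left factor, each constructor having its own
  evaluation rule. This is the existence half of the universal property of the polynomial
  ring.\<close>

lemma poly_value_hom: "poly_value x I \<in> ring_hom (indexed_poly_ring R I) S"
proof (rule ring_hom_memI)
  fix p q assume "p \<in> carrier (indexed_poly_ring R I)" "q \<in> carrier (indexed_poly_ring R I)"
  then have p: "p \<in> R.indexed_pset I (carrier R)" and q: "q \<in> R.indexed_pset I (carrier R)"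
    by simp_all
  note Q = R.indexed_pset_coeff[OF q]
  show "poly_value x I p \<in> carrier S" by (rule poly_value_closed[OF R.indexed_pset_coeff[OF p]])
  show "poly_value x I (p \<oplus>\<^bsub>indexed_poly_ring R I\<^esub> q) = poly_value x I p \<oplus>\<^bsub>S\<^esub> poly_value x I q"
    by (simp add: poly_value_padd p q)
  have "poly_value x I (R.convolution p q) = poly_value x I p \<otimes>\<^bsub>S\<^esub> poly_value x I q"
    using p
  proof induction
    case (indexed_const k)
    then show ?case
      by (simp add: R.convolution_const Q poly_value_smult q poly_value_const)
  next
    case (indexed_padd p1 p2)
    then show ?case
      by (simp add: R.convolution_padd R.indexed_pset_coeff Q poly_value_padd R.convolution_closed q
          S.l_distr poly_value_closed)
  next
    case (indexed_pmult p i)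
    then show ?case using x
      by (simp add: R.convolution_pmult R.indexed_pset_coeff Q poly_value_pmult R.convolution_closed q
          poly_value_closed S.m_ac Pi_def)
  qed
  then show "poly_value x I (p \<otimes>\<^bsub>indexed_poly_ring R I\<^esub> q) = poly_value x I p \<otimes>\<^bsub>S\<^esub> poly_value x I q"
    by simp
qed (simp add: poly_value_const)

lemma poly_value_var: "i \<in> I \<Longrightarrow> poly_value x I (R.indexed_var i) = x i"
  using x by (simp add: R.indexed_var_def poly_value_pmult poly_value_const R.indexed_pset.indexed_const Pi_def)

end

end

declare (in cring) indexed_poly_ring_simps [simp del]

text \<open>It expresses the constructor as a ring product, to which ring homomorphisms can be
  applied.\<close>

lemma (in cring) indexed_pmult_eq_mult_var:
  assumes "p \<in> carrier (indexed_poly_ring R I)"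
  shows "indexed_pmult p i = p \<otimes>\<^bsub>indexed_poly_ring R I\<^esub> indexed_var i"
proof -
  have p: "carrier_coeff p" using assms by (simp add: indexed_poly_ring_simps indexed_pset_coeff)
  have c: "carrier_coeff (indexed_const \<one>)" by (simp add: carrier_coeff_def indexed_const_def)
  have "convolution p (indexed_var i) = convolution (indexed_var i) p"
    unfolding indexed_var_def by (rule convolution_commute[OF p indexed_pmult_in_carrier[OF c]])
  also have "\<dots> = indexed_pmult p i"
    unfolding indexed_var_def using p carrier_coeffE[OF p]
    by (simp add: convolution_pmult c convolution_const)
  finally show ?thesis by (simp add: indexed_poly_ring_simps)
qed

text \<open>Constants and variables generate the polynomial ring; this is the uniqueness half of its
  universal property.\<close>

lemma (in cring) indexed_poly_hom_unique:
  assumes "g \<in> ring_hom (indexed_poly_ring R I) S" "g' \<in> ring_hom (indexed_poly_ring R I) S"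
    and const: "\<And>r. r \<in> carrier R \<Longrightarrow> g (indexed_const r) = g' (indexed_const r)"
    and var: "\<And>i. i \<in> I \<Longrightarrow> g (indexed_var i) = g' (indexed_var i)"
    and p: "p \<in> carrier (indexed_poly_ring R I)"
  shows "g p = g' p"
  using p unfolding indexed_poly_ring_simps
proof induction
  case (indexed_padd p q)
  then show ?case
    using ring_hom_add[OF assms(1), of p q] ring_hom_add[OF assms(2), of p q]
    by (simp add: indexed_poly_ring_simps)
next
  case (indexed_pmult p i)
  then have "p \<in> carrier (indexed_poly_ring R I)" "indexed_var i \<in> carrier (indexed_poly_ring R I)"
    by (simp_all add: indexed_poly_ring_simps indexed_var_def indexed_pset.intros)
  then show ?case
    using indexed_pmult ring_hom_mult[OF assms(1)] ring_hom_mult[OF assms(2)]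
    by (simp add: indexed_pmult_eq_mult_var var)
qed (rule const)

section \<open>Points of the quadric\<close>

text \<open>The form q over an arbitrary ring. Squares are written as products, so that no powers
  occur in later ring computations.\<close>

definition quadratic_form :: "('c, 'k) ring_scheme \<Rightarrow> 'c \<Rightarrow> 'c \<Rightarrow> 'c \<Rightarrow> 'c \<Rightarrow> 'c \<Rightarrow> 'c"
  where "quadratic_form R a b c x y =
    a \<otimes>\<^bsub>R\<^esub> (x \<otimes>\<^bsub>R\<^esub> x) \<oplus>\<^bsub>R\<^esub> b \<otimes>\<^bsub>R\<^esub> (x \<otimes>\<^bsub>R\<^esub> y) \<oplus>\<^bsub>R\<^esub> c \<otimes>\<^bsub>R\<^esub> (y \<otimes>\<^bsub>R\<^esub> y)"

lemma (in cring) quadratic_form_closed [simp]: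
  "\<lbrakk>a \<in> carrier R; b \<in> carrier R; c \<in> carrier R; x \<in> carrier R; y \<in> carrier R\<rbrakk>
    \<Longrightarrow> quadratic_form R a b c x y \<in> carrier R"
  by (simp add: quadratic_form_def)

lemma (in ring_hom_cring) hom_quadratic_form:
  "\<lbrakk>a \<in> carrier R; b \<in> carrier R; c \<in> carrier R; x \<in> carrier R; y \<in> carrier R\<rbrakk>
    \<Longrightarrow> h (quadratic_form R a b c x y) = quadratic_form S (h a) (h b) (h c) (h x) (h y)"
  by (simp add: quadratic_form_def)

locale quadric = cring B for B (structure) +
  fixes a b c
  assumes abc [simp]: "a \<in> carrier B" "b \<in> carrier B" "c \<in> carrier B"
begin

abbreviation P where "P \<equiv> indexed_poly_ring B {0, 1 :: nat}"
abbreviation A where "A \<equiv> quadric_algebra B a b c"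
abbreviation \<phi> where "\<phi> \<equiv> quadric_structure_map B a b c"
abbreviation K where "K \<equiv> quadric_ideal B a b c"
abbreviation coord where "coord i \<equiv> K +>\<^bsub>P\<^esub> indexed_var i"

text \<open>The index set \<open>{0, 1}\<close> of the polynomial ring must not be rewritten to \<open>{0, Suc 0}\<close>.\<close>

declare One_nat_def [simp del]

sublocale P: cring P by (rule indexed_poly_cring)

lemma const_closed [simp]: "r \<in> carrier B \<Longrightarrow> indexed_const r \<in> carrier P"
  by (simp add: indexed_poly_ring_simps indexed_pset.indexed_const)

lemma var_closed [simp]: "indexed_var 0 \<in> carrier P" "indexed_var 1 \<in> carrier P"
  by (simp_all add: indexed_poly_ring_simps indexed_var_def indexed_pset.intros)

lemma quadric_poly_eq:
  "quadric_poly B a b c = quadratic_form P (indexed_const a) (indexed_const b) (indexed_const c)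
    (indexed_var 0) (indexed_var 1) \<ominus>\<^bsub>P\<^esub> \<one>\<^bsub>P\<^esub>"
  by (simp add: quadric_poly_def quadratic_form_def Let_def numeral_2_eq_2 P.m_assoc)

lemma quadric_poly_closed [simp]: "quadric_poly B a b c \<in> carrier P"
  by (simp add: quadric_poly_eq)

sublocale K: ideal K P
  unfolding quadric_ideal_def by (rule P.genideal_ideal) simp

lemma quadric_poly_in_ideal: "quadric_poly B a b c \<in> K"
  unfolding quadric_ideal_def by (rule P.genideal_self') simp

lemma A_eq: "A = P Quot K" by (simp add: quadric_algebra_def)

lemma A_cring: "cring A"
  unfolding A_eq by (rule K.quotient_is_cring) (rule P.cring_axioms)

sublocale A: cring A by (rule A_cring)

lemma proj_hom: "(+>\<^bsub>P\<^esub>) K \<in> ring_hom P A"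
  unfolding A_eq by (rule K.rcos_ring_hom)

lemma const_hom: "indexed_const \<in> ring_hom B P"
proof (rule ring_hom_memI)
  fix r s assume rs: "r \<in> carrier B" "s \<in> carrier B"
  then have "carrier_coeff (indexed_const s :: nat multiset \<Rightarrow> _)"
    by (simp add: carrier_coeff_def indexed_const_def)
  then show "indexed_const (r \<otimes> s) = indexed_const r \<otimes>\<^bsub>P\<^esub> indexed_const s"
    using rs by (simp add: indexed_poly_ring_simps convolution_const) (auto simp: indexed_const_def)
qed (simp_all add: indexed_poly_ring_simps indexed_pset.indexed_const indexed_padd_const)

lemma structure_map_eq: "\<phi> = (+>\<^bsub>P\<^esub>) K \<circ> indexed_const"
  by (auto simp: quadric_structure_map_def)

lemma structure_map_hom: "ring_hom_cring B A \<phi>"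
  by (rule UnivPoly.ring_hom_cringI)
    (use cring_axioms A_cring ring_hom_trans[OF const_hom proj_hom] in \<open>auto simp: structure_map_eq\<close>)

lemma coord_closed [simp]: "coord 0 \<in> carrier A" "coord 1 \<in> carrier A"
  by (rule ring_hom_closed[OF proj_hom], simp)+

lemma quadric_finitely_presented: "finitely_presented B A \<phi>"
proof -
  have "{..<2::nat} = {0, 1}" by auto
  moreover have "id \<in> ring_iso A A" by (rule ring_iso_set_refl)
  ultimately show ?thesis
    unfolding finitely_presented_def Let_def
    by (intro exI[of _ 2] exI[of _ "{quadric_poly B a b c}"] exI[of _ id])
      (simp add: A_eq quadric_ideal_def quadric_structure_map_def)
qed

text \<open>The class of the defining polynomial is zero in \<open>A\<close>, and \<open>v\<close>
  carries this relation between the coordinates over to \<open>C\<close>.\<close>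

lemma hom_to_point:
  assumes C: "cring C" and v: "v \<in> ring_hom A C"
  shows "quadratic_form C (v (\<phi> a)) (v (\<phi> b)) (v (\<phi> c)) (v (coord 0)) (v (coord 1)) = \<one>\<^bsub>C\<^esub>"
proof -
  define g where "g = v \<circ> (+>\<^bsub>P\<^esub>) K"
  interpret g: ring_hom_cring P C g
    by (rule UnivPoly.ring_hom_cringI[OF P.cring_axioms C])
      (use ring_hom_trans[OF proj_hom v] in \<open>simp add: g_def\<close>)
  have "K +>\<^bsub>P\<^esub> quadric_poly B a b c = \<zero>\<^bsub>A\<^esub>"
    using quadric_poly_in_ideal by (simp add: A_eq FactRing_def K.a_rcos_const)
  then have "g (quadric_poly B a b c) = \<zero>\<^bsub>C\<^esub>"
    using ring_hom_zero[OF v A.ring_axioms g.S.ring_axioms] by (simp add: g_def)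
  then have "g (quadratic_form P (indexed_const a) (indexed_const b) (indexed_const c)
      (indexed_var 0) (indexed_var 1)) \<ominus>\<^bsub>C\<^esub> \<one>\<^bsub>C\<^esub> = \<zero>\<^bsub>C\<^esub>"
    by (simp add: quadric_poly_eq a_minus_def)
  then have "g (quadratic_form P (indexed_const a) (indexed_const b) (indexed_const c)
      (indexed_var 0) (indexed_var 1)) = \<one>\<^bsub>C\<^esub>"
    by (simp add: g.S.r_right_minus_eq)
  then show ?thesis
    by (simp add: g.hom_quadratic_form) (simp add: g_def structure_map_eq)
qed

text \<open>Evaluation at \<open>(x, y)\<close> kills the defining polynomial. Its kernel is an
  ideal and hence contains all of \<open>K\<close>, so evaluation factors through the
  quotient.\<close>

lemma point_to_hom:
  assumes "ring_hom_cring B C \<psi>" and xy: "x \<in> carrier C" "y \<in> carrier C"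
    and 1: "quadratic_form C (\<psi> a) (\<psi> b) (\<psi> c) x y = \<one>\<^bsub>C\<^esub>"
  obtains v where "v \<in> ring_hom A C" "\<And>r. r \<in> carrier B \<Longrightarrow> v (\<phi> r) = \<psi> r"
    "v (coord 0) = x" "v (coord 1) = y"
proof -
  interpret psi: ring_hom_cring B C \<psi> by (rule assms(1))
  define z where "z i = (if i = 0 then x else y)" for i :: nat
  define g where "g = psi.poly_value z {0, 1}"
  have z: "z \<in> {0, 1} \<rightarrow> carrier C" by (simp add: z_def xy)
  have g_const: "g (indexed_const r) = \<psi> r" if "r \<in> carrier B" for r
    unfolding g_def by (rule psi.poly_value_const[OF _ z that]) simp
  have g_var: "g (indexed_var i) = z i" if "i \<in> {0, 1}" for i
    unfolding g_def by (rule psi.poly_value_var[OF _ z that]) simp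
  have g: "g \<in> ring_hom P C" 
    unfolding g_def by (rule psi.poly_value_hom[OF _ z]) simp
  interpret g: ring_hom_cring P C g
    by (rule UnivPoly.ring_hom_cringI[OF P.cring_axioms psi.S.cring_axioms g])
  have "g (quadric_poly B a b c) = \<zero>\<^bsub>C\<^esub>"
  proof -
    have "g (indexed_var 0) = x" "g (indexed_var 1) = y"
      using g_var[of 0] g_var[of 1] by (simp_all add: z_def)
    then have "g (quadratic_form P (indexed_const a) (indexed_const b) (indexed_const c)
        (indexed_var 0) (indexed_var 1)) = \<one>\<^bsub>C\<^esub>"
      by (simp add: g.hom_quadratic_form g_const 1)
    then show ?thesis by (simp add: quadric_poly_eq a_minus_def psi.S.r_neg)
  qed
  then have "{quadric_poly B a b c} \<subseteq> a_kernel P C g"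
    using quadric_poly_closed unfolding a_kernel_def' by blast
  then have "K \<subseteq> a_kernel P C g"
    unfolding quadric_ideal_def by (rule P.genideal_minimal[OF g.ring.kernel_is_ideal])
  then have g_zero: "g p = \<zero>\<^bsub>C\<^esub>" if "p \<in> K" for p
    using that unfolding a_kernel_def' by blast
  obtain v where v: "v \<in> ring_hom A C" "\<And>p. p \<in> carrier P \<Longrightarrow> v (K +>\<^bsub>P\<^esub> p) = g p"
    by (rule g.ring.hom_factor_through_quotient[OF K.is_ideal, folded A_eq])
      (erule g_zero, rule that)
  show thesis
  proof
    show "v \<in> ring_hom A C" by (rule v(1))
    show "v (\<phi> r) = \<psi> r" if "r \<in> carrier B" for r
      using that by (simp add: structure_map_eq v(2) g_const)
    show "v (coord 0) = x" "v (coord 1) = y"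
      using g_var[of 0] g_var[of 1] by (simp_all add: v(2) z_def)
  qed
qed

text \<open>The two coordinates generate \<open>A\<close> over \<open>B\<close>. With the two
  preceding lemmas, \<open>B\<close>-algebra homomorphisms from \<open>A\<close> to \<open>C\<close>
  are the same as points of the quadric over \<open>C\<close>.\<close>

lemma hom_unique:
  assumes "v \<in> ring_hom A C" "v' \<in> ring_hom A C"
    and "\<And>r. r \<in> carrier B \<Longrightarrow> v (\<phi> r) = v' (\<phi> r)"
    and "v (coord 0) = v' (coord 0)" "v (coord 1) = v' (coord 1)"
    and z: "z \<in> carrier A"
  shows "v z = v' z"
proof -
  obtain p where p: "p \<in> carrier P" and z: "z = K +>\<^bsub>P\<^esub> p"
    using z by (auto simp: A_eq FactRing_def A_RCOSETS_def')
  have "(v \<circ> (+>\<^bsub>P\<^esub>) K) p = (v' \<circ> (+>\<^bsub>P\<^esub>) K) p"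
    by (rule indexed_poly_hom_unique[OF ring_hom_trans[OF proj_hom assms(1)]
          ring_hom_trans[OF proj_hom assms(2)] _ _ p])
      (use assms(3-5) in \<open>auto simp: structure_map_eq\<close>)
  then show ?thesis by (simp add: z)
qed

text \<open>A homomorphism into the quotient by \<open>J\<close> is a point of the quadric modulo
  \<open>J\<close>. Lifting it means choosing representatives of its coordinates that satisfy the
  equation exactly.\<close>

lemma infinitesimal_lifting_iff:
  fixes C :: "'c ring"
  assumes C: "cring C"
  shows "infinitesimal_lifting B A \<phi> C \<longleftrightarrow>
    (\<forall>\<psi> J x y. ring_hom_cring B C \<psi> \<and> ideal J C \<and> (\<forall>s \<in> J. \<forall>t \<in> J. s \<otimes>\<^bsub>C\<^esub> t = \<zero>\<^bsub>C\<^esub>) \<and>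
        x \<in> carrier C \<and> y \<in> carrier C \<and> quadratic_form C (\<psi> a) (\<psi> b) (\<psi> c) x y \<ominus>\<^bsub>C\<^esub> \<one>\<^bsub>C\<^esub> \<in> J \<longrightarrow>
      (\<exists>x' y'. x' \<in> carrier C \<and> y' \<in> carrier C \<and> x' \<ominus>\<^bsub>C\<^esub> x \<in> J \<and> y' \<ominus>\<^bsub>C\<^esub> y \<in> J \<and>
        quadratic_form C (\<psi> a) (\<psi> b) (\<psi> c) x' y' = \<one>\<^bsub>C\<^esub>))"
    (is "_ \<longleftrightarrow> ?points")
proof -
  interpret C: cring C by (rule C)
  have quot: "ring_hom_cring C (C Quot J) ((+>\<^bsub>C\<^esub>) J)" if "ideal J C" for J
    by (rule ideal.rcos_ring_hom_cring[OF that C])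
  have coset: "J +>\<^bsub>C\<^esub> x = J +>\<^bsub>C\<^esub> y \<longleftrightarrow> x \<ominus>\<^bsub>C\<^esub> y \<in> J"
    if "ideal J C" "x \<in> carrier C" "y \<in> carrier C" for J x y
    using C.quotient_eq_iff_same_a_r_cos[OF that] by blast
  have form: "quadratic_form (C Quot J) (J +>\<^bsub>C\<^esub> \<psi> a) (J +>\<^bsub>C\<^esub> \<psi> b) (J +>\<^bsub>C\<^esub> \<psi> c) (J +>\<^bsub>C\<^esub> x) (J +>\<^bsub>C\<^esub> y) =
      \<one>\<^bsub>C Quot J\<^esub> \<longleftrightarrow> quadratic_form C (\<psi> a) (\<psi> b) (\<psi> c) x y \<ominus>\<^bsub>C\<^esub> \<one>\<^bsub>C\<^esub> \<in> J"
    if psi: "ring_hom_cring B C \<psi>" and J: "ideal J C" and xy: "x \<in> carrier C" "y \<in> carrier C" for \<psi> J x y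
  proof -
    interpret psi: ring_hom_cring B C \<psi> by (rule psi)
    interpret q: ring_hom_cring C "C Quot J" "(+>\<^bsub>C\<^esub>) J" by (rule quot[OF J])
    show ?thesis
      using coset[OF J, of "quadratic_form C (\<psi> a) (\<psi> b) (\<psi> c) x y" "\<one>\<^bsub>C\<^esub>"] xy
      by (simp add: q.hom_quadratic_form[symmetric])
  qed
  show ?thesis
  proof
    assume lift: "infinitesimal_lifting B A \<phi> C"
    show ?points
    proof (intro allI impI, elim conjE)
      fix \<psi> J x y
      assume psi: "ring_hom_cring B C \<psi>" and J: "ideal J C" and sq: "\<forall>s \<in> J. \<forall>t \<in> J. s \<otimes>\<^bsub>C\<^esub> t = \<zero>\<^bsub>C\<^esub>"
        and xy: "x \<in> carrier C" "y \<in> carrier C"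
        and in_J: "quadratic_form C (\<psi> a) (\<psi> b) (\<psi> c) x y \<ominus>\<^bsub>C\<^esub> \<one>\<^bsub>C\<^esub> \<in> J"
      interpret psi: ring_hom_cring B C \<psi> by (rule psi)
      interpret q: ring_hom_cring C "C Quot J" "(+>\<^bsub>C\<^esub>) J" by (rule quot[OF J])
      have "ring_hom_cring B (C Quot J) (\<lambda>r. J +>\<^bsub>C\<^esub> \<psi> r)"
        by (rule UnivPoly.ring_hom_cringI[OF cring_axioms q.S.cring_axioms])
          (use ring_hom_trans[OF psi.homh q.homh] in \<open>simp add: comp_def\<close>)
      then obtain u where u: "u \<in> ring_hom A (C Quot J)"
        and u_const: "\<And>r. r \<in> carrier B \<Longrightarrow> u (\<phi> r) = J +>\<^bsub>C\<^esub> \<psi> r"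
        and u_coord: "u (coord 0) = J +>\<^bsub>C\<^esub> x" "u (coord 1) = J +>\<^bsub>C\<^esub> y"
        by (rule point_to_hom[where x = "J +>\<^bsub>C\<^esub> x" and y = "J +>\<^bsub>C\<^esub> y"])
          (use form[OF psi J xy] in_J xy in auto)
      have "\<exists>v \<in> ring_hom A C. (\<forall>r \<in> carrier B. v (\<phi> r) = \<psi> r) \<and>
          (\<forall>z \<in> carrier A. J +>\<^bsub>C\<^esub> v z = u z)"
        by (rule lift[unfolded infinitesimal_lifting_def, THEN spec, THEN spec, THEN spec, THEN mp])
          (use psi J sq u u_const in simp)
      then obtain v where v: "v \<in> ring_hom A C" and v_const: "\<forall>r \<in> carrier B. v (\<phi> r) = \<psi> r"
        and v_u: "\<forall>z \<in> carrier A. J +>\<^bsub>C\<^esub> v z = u z"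
        by blast
      have closed: "v (coord 0) \<in> carrier C" "v (coord 1) \<in> carrier C"
        using ring_hom_closed[OF v] by simp_all
      have "J +>\<^bsub>C\<^esub> v (coord 0) = J +>\<^bsub>C\<^esub> x" "J +>\<^bsub>C\<^esub> v (coord 1) = J +>\<^bsub>C\<^esub> y"
        using v_u u_coord by simp_all
      then show "\<exists>x' y'. x' \<in> carrier C \<and> y' \<in> carrier C \<and> x' \<ominus>\<^bsub>C\<^esub> x \<in> J \<and> y' \<ominus>\<^bsub>C\<^esub> y \<in> J \<and>
          quadratic_form C (\<psi> a) (\<psi> b) (\<psi> c) x' y' = \<one>\<^bsub>C\<^esub>"
        using closed xy hom_to_point[OF C v] v_const
        by (intro exI[of _ "v (coord 0)"] exI[of _ "v (coord 1)"]) (simp add: coset[OF J])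
    qed
  next
    assume points: ?points
    show "infinitesimal_lifting B A \<phi> C"
      unfolding infinitesimal_lifting_def
    proof (intro allI impI, elim conjE)
      fix \<psi> J u
      assume psi: "ring_hom_cring B C \<psi>" and J: "ideal J C" and sq: "\<forall>s \<in> J. \<forall>t \<in> J. s \<otimes>\<^bsub>C\<^esub> t = \<zero>\<^bsub>C\<^esub>"
        and u: "u \<in> ring_hom A (C Quot J)" and u_const: "\<forall>r \<in> carrier B. u (\<phi> r) = J +>\<^bsub>C\<^esub> \<psi> r"
      interpret psi: ring_hom_cring B C \<psi> by (rule psi)
      interpret q: ring_hom_cring C "C Quot J" "(+>\<^bsub>C\<^esub>) J" by (rule quot[OF J])
      have "\<exists>x \<in> carrier C. u z = J +>\<^bsub>C\<^esub> x" if "z \<in> carrier A" for z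
        using ring_hom_closed[OF u that] unfolding FactRing_def A_RCOSETS_def' by auto
      from this[OF coord_closed(1)] this[OF coord_closed(2)]
      obtain x y where xy: "x \<in> carrier C" "y \<in> carrier C"
        and u_coord: "u (coord 0) = J +>\<^bsub>C\<^esub> x" "u (coord 1) = J +>\<^bsub>C\<^esub> y"
        by (elim bexE)
      have "quadratic_form C (\<psi> a) (\<psi> b) (\<psi> c) x y \<ominus>\<^bsub>C\<^esub> \<one>\<^bsub>C\<^esub> \<in> J"
        using hom_to_point[OF q.S.cring_axioms u] u_const u_coord form[OF psi J xy] by simp
      then have "\<exists>x' y'. x' \<in> carrier C \<and> y' \<in> carrier C \<and> x' \<ominus>\<^bsub>C\<^esub> x \<in> J \<and> y' \<ominus>\<^bsub>C\<^esub> y \<in> J \<and>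
          quadratic_form C (\<psi> a) (\<psi> b) (\<psi> c) x' y' = \<one>\<^bsub>C\<^esub>"
        by (intro points[THEN spec, THEN spec, THEN spec, THEN spec, THEN mp]) (use psi J sq xy in simp)
      then obtain x' y' where xy': "x' \<in> carrier C" "y' \<in> carrier C"
        and diff: "x' \<ominus>\<^bsub>C\<^esub> x \<in> J" "y' \<ominus>\<^bsub>C\<^esub> y \<in> J"
        and 1: "quadratic_form C (\<psi> a) (\<psi> b) (\<psi> c) x' y' = \<one>\<^bsub>C\<^esub>"
        by blast
      obtain v where v: "v \<in> ring_hom A C" and v_const: "\<And>r. r \<in> carrier B \<Longrightarrow> v (\<phi> r) = \<psi> r"
        and v_coord: "v (coord 0) = x'" "v (coord 1) = y'"
        by (rule point_to_hom[OF psi xy' 1]) (rule that)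
      \<comment> \<open>Both homomorphisms agree on constants and on coordinates, the latter because
        the moved point is congruent to the old one modulo \<open>J\<close>.\<close>
      have "((+>\<^bsub>C\<^esub>) J \<circ> v) z = u z" if "z \<in> carrier A" for z
        by (rule hom_unique[OF ring_hom_trans[OF v q.homh] u _ _ _ that])
          (use diff coset[OF J] xy xy' in \<open>simp_all add: v_const u_const v_coord u_coord\<close>)
      then show "\<exists>v \<in> ring_hom A C. (\<forall>r \<in> carrier B. v (\<phi> r) = \<psi> r) \<and>
          (\<forall>z \<in> carrier A. J +>\<^bsub>C\<^esub> v z = u z)"
        using v v_const by auto
    qed
  qed
qed

end

section \<open>Nilpotence from a univariate polynomial ring\<close>

lemma (in UP_ring) coeff_monom_mult_less:
  assumes "c \<in> carrier R" "p \<in> carrier P" "n < k"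
  shows "up_ring.coeff P (up_ring.monom P c k \<otimes>\<^bsub>P\<^esub> p) n = \<zero>"
proof -
  have "up_ring.coeff P (up_ring.monom P c k \<otimes>\<^bsub>P\<^esub> p) n = (\<Oplus>i\<in>{..n}. \<zero>)"
    unfolding coeff_mult[OF monom_closed[OF assms(1)] assms(2)]
    by (rule R.finsum_cong') (use assms in auto)
  then show ?thesis by simp
qed

text \<open>The constant coefficient of \<open>h\<close> is a unit, so \<open>h\<close> is no zero
  divisor and \<open>hg\<close> can be cancelled to make \<open>g\<close> the inverse of
  \<open>h\<close>. The coefficients of \<open>g\<close> can then be computed.\<close>

lemma (in UP_cring) nilpotent_if_square_dvd_self:
  assumes a: "a \<in> carrier R" and g: "g \<in> carrier P"
    and h: "h = up_ring.monom P a 2 \<ominus>\<^bsub>P\<^esub> \<one>\<^bsub>P\<^esub>" and hg: "h = g \<otimes>\<^bsub>P\<^esub> (h \<otimes>\<^bsub>P\<^esub> h)"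
  shows "\<exists>n::nat. a [^] n = \<zero>"
proof -
  let ?m = "up_ring.monom P a 2"
  have m: "?m \<in> carrier P" using a by simp
  have hc: "h \<in> carrier P" using m by (simp add: h)
  have m_eq: "?m \<otimes>\<^bsub>P\<^esub> p = h \<otimes>\<^bsub>P\<^esub> p \<oplus>\<^bsub>P\<^esub> p" if "p \<in> carrier P" for p
    unfolding h using m that by algebra
  define e where "e = g \<otimes>\<^bsub>P\<^esub> h \<ominus>\<^bsub>P\<^esub> \<one>\<^bsub>P\<^esub>"
  have e: "e \<in> carrier P" using g hc by (simp add: e_def)
  have "h \<otimes>\<^bsub>P\<^esub> e = g \<otimes>\<^bsub>P\<^esub> (h \<otimes>\<^bsub>P\<^esub> h) \<ominus>\<^bsub>P\<^esub> h"
    unfolding e_def using g hc by algebra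
  also have "\<dots> = \<zero>\<^bsub>P\<^esub>" using hc hg by (metis P.r_right_minus_eq)
  finally have me: "?m \<otimes>\<^bsub>P\<^esub> e = e" using m_eq[OF e] e by simp
  \<comment> \<open>Multiplication by \<open>?m\<close> raises degrees by two. Since
    \<open>e\<close> equals its own multiple by \<open>?m\<close>, its coefficients vanish from the
    bottom up.\<close>
  have "up_ring.coeff P e n = \<zero>" for n
  proof (induction n rule: less_induct)
    case (less n)
    show ?case
    proof (cases "n < 2")
      case True
      then show ?thesis using coeff_monom_mult_less[OF a e True] by (simp add: me)
    next
      case False
      then obtain k where "n = k + 2" by (metis add.commute le_Suc_ex not_less)
      then show ?thesis using coeff_monom_mult[OF a e, of 2 k] less[of k] a by (simp add: me)
    qed
  qed
  then have "e = \<zero>\<^bsub>P\<^esub>" using e by (intro up_eqI) simp_all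
  then have "h \<otimes>\<^bsub>P\<^esub> g = \<one>\<^bsub>P\<^esub>"
    using g hc by (simp add: e_def P.m_comm)
  then have mg: "?m \<otimes>\<^bsub>P\<^esub> g = \<one>\<^bsub>P\<^esub> \<oplus>\<^bsub>P\<^esub> g" using m_eq[OF g] by simp
  \<comment> \<open>Comparing coefficients in \<open>mg\<close> yields a recursion with step two
    that starts at minus one.\<close>
  have coeff_g: "up_ring.coeff P g (2 * n) = \<ominus> (a [^] n)" for n
  proof (induction n)
    case 0
    have "\<one> \<oplus> up_ring.coeff P g 0 = \<zero>"
      using coeff_monom_mult_less[OF a g, of 0 2] g by (simp add: mg)
    then show ?case
      using g R.minus_equality[of "up_ring.coeff P g 0" \<one>] by (simp add: R.a_comm)
  next
    case (Suc n)
    have "up_ring.coeff P g (2 * n + 2) = a \<otimes> up_ring.coeff P g (2 * n)"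
      using coeff_monom_mult[OF a g, of 2 "2 * n"] g by (simp add: mg)
    then show ?case using Suc a by (simp add: R.r_minus R.m_comm)
  qed
  \<comment> \<open>The \<open>Suc\<close> pushes the index above the degree of \<open>g\<close>
    even when that degree is zero.\<close>
  have "\<ominus> (a [^] Suc (deg R g)) = \<zero>"
    using deg_aboveD[of g "2 * Suc (deg R g)"] g coeff_g[of "Suc (deg R g)"] by simp
  then show ?thesis using a by (metis R.minus_minus R.minus_zero R.nat_pow_closed)
qed

section \<open>Moving points by square-zero ideals\<close>

text \<open>Without the mixed term only squares occur, and \<open>z'\<close> and \<open>z\<close>
  have the same square: the cross term has the factor 2, and the square of the difference vanishes
  by \<open>J(2)\<close>. No move within \<open>J\<close> can therefore repair a failing
  equation.\<close>

lemma (in cring) quadratic_form_char_two_cong: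
  assumes J: "ideal J R" "\<And>s t. \<lbrakk>s \<in> J; t \<in> J\<rbrakk> \<Longrightarrow> s \<otimes> t = \<zero>" and two: "\<one> \<oplus> \<one> = \<zero>"
    and "a \<in> carrier R" "c \<in> carrier R"
    and "x \<in> carrier R" "y \<in> carrier R" "x' \<in> carrier R" "y' \<in> carrier R"
    and "x' \<ominus> x \<in> J" "y' \<ominus> y \<in> J"
  shows "quadratic_form R a \<zero> c x' y' = quadratic_form R a \<zero> c x y"
proof -
  have sq: "z' \<otimes> z' = z \<otimes> z" if "z \<in> carrier R" "z' \<in> carrier R" "z' \<ominus> z \<in> J" for z z'
  proof -
    have "z' \<otimes> z' = z \<otimes> z \<oplus> (\<one> \<oplus> \<one>) \<otimes> (z \<otimes> (z' \<ominus> z)) \<oplus> (z' \<ominus> z) \<otimes> (z' \<ominus> z)"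
      using that(1,2) by algebra
    also have "\<dots> = z \<otimes> z"
      using that J(2) by (simp add: two)
    finally show ?thesis .
  qed
  show ?thesis using assms sq[of x x'] sq[of y y'] by (simp add: quadratic_form_def)
qed


text \<open>This is Frobenius modulo 2. The square of \<open>u \<oplus> v\<close> is the sum of two
  squares and a cross term in \<open>I\<close>, and the induction hypothesis is applied twice, once
  for each of the two additions.\<close>

lemma (in cring) sum_two_power_in_ideal:
  assumes I: "ideal I R" and two: "\<one> \<oplus> \<one> \<in> I" and "u \<in> carrier R" "v \<in> carrier R"
    and "u [^] (2 ^ k :: nat) \<in> I" "v [^] (2 ^ k :: nat) \<in> I"
  shows "(u \<oplus> v) [^] (2 ^ k :: nat) \<in> I"
  using assms(3-6)
proof (induction k arbitrary: u v)
  case 0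
  interpret I: ideal I R by (rule I)
  show ?case using 0 by simp
next
  case (Suc k)
  interpret I: ideal I R by (rule I)
  have sq: "(z \<otimes> z) [^] (2 ^ k :: nat) = z [^] (2 ^ Suc k :: nat)" if "z \<in> carrier R" for z
    using that nat_pow_pow[of z 2 "2 ^ k"] by (simp add: numeral_2_eq_2)
  define w where "w = (\<one> \<oplus> \<one>) \<otimes> (u \<otimes> v)"
  have w: "w \<in> I" using two Suc.prems by (simp add: w_def I.I_r_closed)
  have wk: "w [^] (2 ^ k :: nat) \<in> I"
  proof -
    obtain n where "2 ^ k = Suc n" by (metis not0_implies_Suc power_not_zero zero_neq_numeral)
    then show ?thesis using w by (simp add: I.I_l_closed I.Icarr)
  qed
  have "(u \<oplus> v) \<otimes> (u \<oplus> v) = (u \<otimes> u \<oplus> v \<otimes> v) \<oplus> w"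
    unfolding w_def using Suc.prems(1,2) by (simp add: l_distr r_distr m_ac a_ac)
  moreover have "(u \<otimes> u \<oplus> v \<otimes> v \<oplus> w) [^] (2 ^ k :: nat) \<in> I"
    using Suc.prems by (intro Suc.IH wk) (simp_all add: sq I.Icarr[OF w] del: power_Suc)
  ultimately show ?case using sq[of "u \<oplus> v"] Suc.prems by (simp del: power_Suc)
qed

text \<open>It brings the unrelated exponents for \<open>a\<close> and \<open>c\<close> to one
  common power of two.\<close>

lemma (in ideal) two_power_in_ideal:
  assumes "u \<in> carrier R" "u [^] (n :: nat) \<in> I"
  shows "\<exists>k0. \<forall>k \<ge> k0. u [^] (2 ^ k :: nat) \<in> I"
proof (intro exI allI impI)
  fix k :: nat assume "k \<ge> n"
  have "n \<le> 2 ^ k" using \<open>k \<ge> n\<close> by (metis le_trans less_exp less_imp_le)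
  then obtain m where "2 ^ k = n + m" by (metis le_Suc_ex)
  then have "u [^] (2 ^ k :: nat) = u [^] n \<otimes> u [^] m" using assms(1) by (simp add: nat_pow_mult)
  then show "u [^] (2 ^ k :: nat) \<in> I" using assms by (simp add: I_r_closed)
qed

text \<open>With \<open>e\<close> the error of a point and \<open>p\<close>, \<open>q\<close> the
  partial derivatives there, these are the \<open>z\<close> for which a step in \<open>J\<close> can
  correct the error \<open>e \<otimes> z\<close>.\<close>

lemma (in cring) ideal_divisor_lin_comb:
  assumes J: "ideal J R" and e: "e \<in> carrier R" "p \<in> carrier R" "q \<in> carrier R"
  shows "ideal {z \<in> carrier R. \<exists>s \<in> J. \<exists>t \<in> J. e \<otimes> z = p \<otimes> s \<oplus> q \<otimes> t} R" (is "ideal ?T R")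
proof (rule idealI[OF ring_axioms])
  interpret J: ideal J R by (rule J)
  show "subgroup ?T (add_monoid R)"
  proof (rule add.subgroupI)
    have "\<zero> \<in> ?T" using e by (auto intro!: bexI[of _ \<zero>])
    then show "?T \<noteq> {}" by blast
  next
    fix z assume "z \<in> ?T"
    then obtain s t where z: "z \<in> carrier R" "s \<in> J" "t \<in> J" "e \<otimes> z = p \<otimes> s \<oplus> q \<otimes> t" by blast
    then have "e \<otimes> (\<ominus> z) = p \<otimes> (\<ominus> s) \<oplus> q \<otimes> (\<ominus> t)"
      using e J.Icarr by (simp add: r_minus minus_add)
    then show "\<ominus> z \<in> ?T" using z by (blast intro: J.a_inv_closed a_inv_closed)
  next
    fix z z' assume "z \<in> ?T" "z' \<in> ?T"
    then obtain s t s' t' where z: "z \<in> carrier R" "s \<in> J" "t \<in> J" "e \<otimes> z = p \<otimes> s \<oplus> q \<otimes> t"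
      and z': "z' \<in> carrier R" "s' \<in> J" "t' \<in> J" "e \<otimes> z' = p \<otimes> s' \<oplus> q \<otimes> t'" by blast
    then have "e \<otimes> (z \<oplus> z') = p \<otimes> (s \<oplus> s') \<oplus> q \<otimes> (t \<oplus> t')"
      using e J.Icarr by (simp add: r_distr a_ac)
    then show "z \<oplus> z' \<in> ?T" using z z' by (blast intro: J.a_closed a_closed)
  qed auto
  fix z w assume "z \<in> ?T" and w: "w \<in> carrier R"
  then obtain s t where z: "z \<in> carrier R" "s \<in> J" "t \<in> J" "e \<otimes> z = p \<otimes> s \<oplus> q \<otimes> t" by blast
  have st: "s \<in> carrier R" "t \<in> carrier R" using z J.Icarr by auto
  have "e \<otimes> (w \<otimes> z) = w \<otimes> (e \<otimes> z)" using e z(1) w by (simp add: m_ac)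
  also have "\<dots> = p \<otimes> (w \<otimes> s) \<oplus> q \<otimes> (w \<otimes> t)"
    unfolding z(4) using e w st by (simp add: r_distr m_ac)
  finally show 1: "w \<otimes> z \<in> ?T" using z w by (blast intro: J.I_l_closed m_closed)
  then show "z \<otimes> w \<in> ?T" using z w by (simp add: m_comm)
qed

text \<open>The premise \<open>rad\<close> ranges over all ideals because the one it is used for,
  the \<open>T\<close> of the proof, depends on the point and on \<open>J\<close>.\<close>

lemma (in cring) quadric_newton_step:
  assumes J: "ideal J R" and sq: "\<And>s t. \<lbrakk>s \<in> J; t \<in> J\<rbrakk> \<Longrightarrow> s \<otimes> t = \<zero>"
    and abc: "a \<in> carrier R" "b \<in> carrier R" "c \<in> carrier R" and xy: "x \<in> carrier R" "y \<in> carrier R"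
    and e: "quadratic_form R a b c x y \<ominus> \<one> \<in> J"
    and rad: "\<And>T. \<lbrakk>ideal T R; \<one> \<oplus> \<one> \<in> T; b \<in> T\<rbrakk> \<Longrightarrow>
      (\<exists>n::nat. a [^] n \<in> T) \<and> (\<exists>n::nat. c [^] n \<in> T)"
  shows "\<exists>x' y'. x' \<in> carrier R \<and> y' \<in> carrier R \<and> x' \<ominus> x \<in> J \<and> y' \<ominus> y \<in> J \<and>
    quadratic_form R a b c x' y' = \<one>"
proof -
  interpret J: ideal J R by (rule J)
  define q where "q = quadratic_form R a b c x y"
  define \<epsilon> where "\<epsilon> = q \<ominus> \<one>"
  \<comment> \<open>\<open>fx\<close> and \<open>fy\<close> are the partial derivatives of the form
    at \<open>(x, y)\<close>.\<close>
  define fx where "fx = (\<one> \<oplus> \<one>) \<otimes> (a \<otimes> x) \<oplus> b \<otimes> y"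
  define fy where "fy = b \<otimes> x \<oplus> (\<one> \<oplus> \<one>) \<otimes> (c \<otimes> y)"
  have q: "q \<in> carrier R" using abc xy by (simp add: q_def)
  have eps: "\<epsilon> \<in> J" "\<epsilon> \<in> carrier R" using e q by (simp_all add: \<epsilon>_def q_def)
  have q_eq: "q = \<one> \<oplus> \<epsilon>" unfolding \<epsilon>_def using q by algebra
  have f: "fx \<in> carrier R" "fy \<in> carrier R" using abc xy by (simp_all add: fx_def fy_def)
  define T where "T = {z \<in> carrier R. \<exists>s \<in> J. \<exists>t \<in> J. \<epsilon> \<otimes> z = fx \<otimes> s \<oplus> fy \<otimes> t}"
  have T: "ideal T R" unfolding T_def by (rule ideal_divisor_lin_comb[OF J eps(2) f])
  interpret T: ideal T R by (rule T)
  note T_cl = T.a_closed T.I_l_closed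
  have T_I: "z \<in> T" if "z \<in> carrier R" "s \<in> J" "t \<in> J" "\<epsilon> \<otimes> z = fx \<otimes> s \<oplus> fy \<otimes> t" for z s t
    using that unfolding T_def by blast
  have fx_T: "fx \<in> T" by (rule T_I[of _ \<epsilon> \<zero>]) (use f eps in \<open>simp_all add: m_comm\<close>)
  have fy_T: "fy \<in> T" by (rule T_I[of _ \<zero> \<epsilon>]) (use f eps in \<open>simp_all add: m_comm\<close>)
  have eps_T: "\<epsilon> \<in> T" by (rule T_I[of _ \<zero> \<zero>]) (use f eps sq in simp_all)
  \<comment> \<open>Modulo \<open>T\<close> the value \<open>q\<close> equals one, because
    \<open>\<epsilon>\<close> lies in \<open>T\<close>.\<close>
  have cancel: "z \<in> T" if "q \<otimes> z \<in> T" "z \<in> carrier R" for z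
  proof -
    have "z = q \<otimes> z \<oplus> (\<ominus> z) \<otimes> \<epsilon>" unfolding q_eq using that eps(2) by algebra
    then show ?thesis using that eps_T T_cl by (metis a_inv_closed)
  qed
  have two_T: "\<one> \<oplus> \<one> \<in> T"
  proof (rule cancel)
    \<comment> \<open>Euler's formula for a form of degree two.\<close>
    have "q \<otimes> (\<one> \<oplus> \<one>) = x \<otimes> fx \<oplus> y \<otimes> fy"
      unfolding q_def fx_def fy_def quadratic_form_def using abc xy by algebra
    then show "q \<otimes> (\<one> \<oplus> \<one>) \<in> T" using fx_T fy_T xy T_cl by simp
  qed simp
  have T_diff: "u \<in> T" if "u \<oplus> w \<in> T" "w \<in> T" "u \<in> carrier R" for u w
  proof -
    have "u = (u \<oplus> w) \<oplus> \<ominus> w" using that(3) T.Icarr[OF that(2)] by algebra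
    then show ?thesis using that T.a_inv_closed T_cl by metis
  qed
  have bx_T: "b \<otimes> x \<in> T"
    by (rule T_diff[of _ "(\<one> \<oplus> \<one>) \<otimes> (c \<otimes> y)"])
      (use fy_T two_T abc xy in \<open>simp_all add: fy_def T.I_r_closed\<close>)
  have by_T: "b \<otimes> y \<in> T"
    by (rule T_diff[of _ "(\<one> \<oplus> \<one>) \<otimes> (a \<otimes> x)"])
      (use fx_T two_T abc xy in \<open>simp_all add: fx_def T.I_r_closed a_comm\<close>)
  have b_T: "b \<in> T"
  proof (rule cancel)
    \<comment> \<open>Every monomial of the form contains \<open>x\<close> or \<open>y\<close>, so
      each term of the product contains \<open>b \<otimes> x\<close> or
      \<open>b \<otimes> y\<close>.\<close>
    have "q \<otimes> b = (a \<otimes> x) \<otimes> (b \<otimes> x) \<oplus> (b \<otimes> x) \<otimes> (b \<otimes> y) \<oplus> (c \<otimes> y) \<otimes> (b \<otimes> y)"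
      unfolding q_def quadratic_form_def using abc xy by (simp add: l_distr r_distr m_ac)
    then show "q \<otimes> b \<in> T" using bx_T by_T abc xy T_cl by simp
  qed (rule abc)
  obtain n m :: nat where nm: "a [^] n \<in> T" "c [^] m \<in> T"
    using rad[OF T two_T b_T] by blast
  obtain k1 k2 where k: "\<And>k. k \<ge> k1 \<Longrightarrow> a [^] (2 ^ k :: nat) \<in> T"
      "\<And>k. k \<ge> k2 \<Longrightarrow> c [^] (2 ^ k :: nat) \<in> T"
    using T.two_power_in_ideal[OF abc(1) nm(1)] T.two_power_in_ideal[OF abc(3) nm(2)] by blast
  define N :: nat where "N = 2 ^ max k1 k2"
  have N0: "N = Suc (N - 1)" by (simp add: N_def)
  have T_pow: "z [^] N \<in> T" if "z \<in> T" for z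
    using that T.Icarr[OF that] by (subst N0) (simp add: T.I_l_closed)
  \<comment> \<open>All three terms of the form have their \<open>N\<close>-th power in
    \<open>T\<close>, and \<open>N\<close> is a power of two.\<close>
  have "q [^] N \<in> T"
    unfolding q_def quadratic_form_def N_def
  proof (intro sum_two_power_in_ideal[OF T two_T])
    show "(a \<otimes> (x \<otimes> x)) [^] (2 ^ max k1 k2 :: nat) \<in> T" "(c \<otimes> (y \<otimes> y)) [^] (2 ^ max k1 k2 :: nat) \<in> T"
      using k[of "max k1 k2"] abc xy by (simp_all add: nat_pow_distrib T.I_r_closed)
    show "(b \<otimes> (x \<otimes> y)) [^] (2 ^ max k1 k2 :: nat) \<in> T"
      using T_pow[of "b \<otimes> (x \<otimes> y)"] b_T xy by (simp add: N_def T.I_r_closed)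
  qed (use abc xy in auto)
  \<comment> \<open>Each factor \<open>q\<close> acts on \<open>\<epsilon>\<close> as one since
    \<open>\<epsilon>\<close> has square zero. With \<open>i = N\<close> this turns membership of
    the power in \<open>T\<close> into a statement about \<open>\<epsilon>\<close> itself.\<close>
  moreover have "\<epsilon> \<otimes> q [^] i = \<epsilon>" for i :: nat
  proof (induction i)
    case (Suc i)
    have "\<epsilon> \<otimes> q [^] Suc i = (\<epsilon> \<otimes> q [^] i) \<otimes> q" using eps q by (simp add: m_assoc)
    also have "\<dots> = \<epsilon>" using Suc eps sq[of \<epsilon> \<epsilon>] by (simp add: q_eq r_distr)
    finally show ?case .
  qed (use eps in simp)
  ultimately obtain s t where st: "s \<in> J" "t \<in> J" and eps_eq: "\<epsilon> = fx \<otimes> s \<oplus> fy \<otimes> t"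
    unfolding T_def by auto
  define s' t' where "s' = \<ominus> s" and "t' = \<ominus> t"
  have st': "s' \<in> J" "t' \<in> J" "s' \<in> carrier R" "t' \<in> carrier R"
    using st J.Icarr J.a_inv_closed by (auto simp: s'_def t'_def)
  have "fx \<otimes> s' \<oplus> fy \<otimes> t' = \<ominus> \<epsilon>"
    unfolding eps_eq s'_def t'_def using f st J.Icarr by (simp add: r_minus minus_add)
  moreover have "quadratic_form R a b c s' t' = \<zero>"
    using sq st' abc by (simp add: quadratic_form_def)
  \<comment> \<open>The Taylor expansion ends after the second order, and its second-order part is
    the form at \<open>(s', t')\<close>, which vanishes because products within \<open>J\<close>
    do.\<close>
  moreover have "quadratic_form R a b c (x \<oplus> s') (y \<oplus> t') =
      q \<oplus> (fx \<otimes> s' \<oplus> fy \<otimes> t') \<oplus> quadratic_form R a b c s' t'"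
    unfolding q_def fx_def fy_def quadratic_form_def using abc xy st'(3,4)
    by (simp add: l_distr r_distr m_ac a_ac)
  ultimately have "quadratic_form R a b c (x \<oplus> s') (y \<oplus> t') = \<one>"
    using eps by (simp add: q_eq a_assoc r_neg)
  moreover have "(x \<oplus> s') \<ominus> x = s'" "(y \<oplus> t') \<ominus> y = t'"
    using xy st'(3,4) by algebra+
  ultimately show ?thesis using xy st'
    by (intro exI[of _ "x \<oplus> s'"] exI[of _ "y \<oplus> t'"]) simp
qed

section \<open>The smoothness criterion\<close>

lemma (in ideal) coset_eq_zero_iff:
  assumes "x \<in> carrier R"
  shows "I +>\<^bsub>R\<^esub> x = \<zero>\<^bsub>R Quot I\<^esub> \<longleftrightarrow> x \<in> I"
proof -
  have "\<zero>\<^bsub>R Quot I\<^esub> = I" by (simp add: FactRing_def)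
  then show ?thesis using assms by (metis a_rcos_const rcos_const_imp_mem)
qed

text \<open>Here \<open>d\<close> stands for \<open>a\<close> or \<open>c\<close>: the premise
  \<open>pt\<close> represents \<open>d z^2\<close> by the form without its mixed term, so one
  argument serves both. The type of \<open>C\<close> is that of cosets of univariate polynomials
  over cosets of \<open>B\<close>.\<close>

lemma (in quadric) formally_smooth_imp_radical:
  assumes fs: "formally_smooth B A \<phi>" and d: "d \<in> carrier B"
    and pt: "\<And>(C :: (nat \<Rightarrow> 'a set) set ring) \<psi> z. \<lbrakk>ring_hom_cring B C \<psi>; z \<in> carrier C\<rbrakk> \<Longrightarrow>
      \<exists>x \<in> carrier C. \<exists>y \<in> carrier C.
        quadratic_form C (\<psi> a) \<zero>\<^bsub>C\<^esub> (\<psi> c) x y = \<psi> d \<otimes>\<^bsub>C\<^esub> (z \<otimes>\<^bsub>C\<^esub> z)"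
  shows "d \<in> radical_ideal B (Idl {\<one> \<oplus> \<one>, b})"
proof -
  define I where "I = Idl {\<one> \<oplus> \<one>, b}"
  interpret I: ideal I B unfolding I_def by (rule genideal_ideal) simp
  have gens: "\<one> \<oplus> \<one> \<in> I" "b \<in> I"
    using genideal_self[of "{\<one> \<oplus> \<one>, b}"] by (auto simp: I_def)
  define Q where "Q = B Quot I"
  define \<rho> where "\<rho> = (+>) I"
  interpret \<rho>: ring_hom_cring B Q \<rho>
    unfolding Q_def \<rho>_def by (rule I.rcos_ring_hom_cring) (rule cring_axioms)
  have \<rho>_zero: "\<rho> x = \<zero>\<^bsub>Q\<^esub> \<longleftrightarrow> x \<in> I" if "x \<in> carrier B" for x
    unfolding Q_def \<rho>_def by (rule I.coset_eq_zero_iff[OF that])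
  define U where "U = UP Q"
  interpret U: UP_cring Q U
    by (rule UP_cring.intro) (rule \<rho>.S.cring_axioms, simp add: U_def)
  \<comment> \<open>\<open>v\<close> is the variable T of the polynomial ring
    \<open>U\<close>.\<close>
  define v where "v = up_ring.monom U \<one>\<^bsub>Q\<^esub> 1"
  define h where "h = up_ring.monom U (\<rho> d) 2 \<ominus>\<^bsub>U\<^esub> \<one>\<^bsub>U\<^esub>"
  have v: "v \<in> carrier U" by (simp add: v_def)
  have h: "h \<in> carrier U" using d by (simp add: h_def)
  \<comment> \<open>Dividing by the square of \<open>h\<close> gives the class of \<open>h\<close>
    square zero without forcing it to be zero.\<close>
  define H where "H = PIdl\<^bsub>U\<^esub> (h \<otimes>\<^bsub>U\<^esub> h)"
  interpret H: ideal H U unfolding H_def by (rule U.P.cgenideal_ideal) (simp add: h)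
  define C where "C = U Quot H"
  define \<pi> where "\<pi> = (+>\<^bsub>U\<^esub>) H"
  interpret \<pi>: ring_hom_cring U C \<pi>
    unfolding C_def \<pi>_def by (rule H.rcos_ring_hom_cring) (rule U.P.cring_axioms)
  have \<pi>_zero: "\<pi> p = \<zero>\<^bsub>C\<^esub> \<longleftrightarrow> p \<in> H" if "p \<in> carrier U" for p
    unfolding C_def \<pi>_def by (rule H.coset_eq_zero_iff[OF that])
  define \<psi> where "\<psi> r = \<pi> (up_ring.monom U (\<rho> r) 0)" for r
  have "\<psi> = \<pi> \<circ> (\<lambda>r. up_ring.monom U r 0) \<circ> \<rho>" by (auto simp: \<psi>_def)
  then have "\<psi> \<in> ring_hom B C"
    using ring_hom_trans[OF ring_hom_trans[OF \<rho>.homh U.const_ring_hom] \<pi>.homh] by (simp add: comp_assoc)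
  then have psi: "ring_hom_cring B C \<psi>"
    by (rule UnivPoly.ring_hom_cringI[OF cring_axioms \<pi>.S.cring_axioms])
  interpret \<psi>: ring_hom_cring B C \<psi> by (rule psi)
  have "\<psi> (\<one> \<oplus> \<one>) = \<zero>\<^bsub>C\<^esub>" "\<psi> b = \<zero>\<^bsub>C\<^esub>"
    using gens \<rho>_zero[of "\<one> \<oplus> \<one>"] \<rho>_zero[of b] by (simp_all add: \<psi>_def del: \<rho>.hom_add)
  then have two: "\<one>\<^bsub>C\<^esub> \<oplus>\<^bsub>C\<^esub> \<one>\<^bsub>C\<^esub> = \<zero>\<^bsub>C\<^esub>" and psi_b: "\<psi> b = \<zero>\<^bsub>C\<^esub>" by simp_all
  have "up_ring.monom U (\<rho> d) 0 \<otimes>\<^bsub>U\<^esub> (v \<otimes>\<^bsub>U\<^esub> v) = up_ring.monom U (\<rho> d) 2"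
    using d U.monom_mult[of "\<one>\<^bsub>Q\<^esub>" "\<one>\<^bsub>Q\<^esub>" 1 1] U.monom_mult[of "\<rho> d" "\<one>\<^bsub>Q\<^esub>" 0 2]
    by (simp add: v_def numeral_2_eq_2 del: U.monom_mult One_nat_def)
  then have dXX: "\<psi> d \<otimes>\<^bsub>C\<^esub> (\<pi> v \<otimes>\<^bsub>C\<^esub> \<pi> v) = \<pi> (up_ring.monom U (\<rho> d) 2)"
    using d v by (simp add: \<psi>_def flip: \<pi>.hom_mult)
  obtain x y where xy: "x \<in> carrier C" "y \<in> carrier C"
    and form_xy: "quadratic_form C (\<psi> a) \<zero>\<^bsub>C\<^esub> (\<psi> c) x y = \<pi> (up_ring.monom U (\<rho> d) 2)"
    using pt[OF psi \<pi>.hom_closed[OF v]] dXX by auto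
  have form_h: "quadratic_form C (\<psi> a) \<zero>\<^bsub>C\<^esub> (\<psi> c) x y \<ominus>\<^bsub>C\<^esub> \<one>\<^bsub>C\<^esub> = \<pi> h"
    using d by (simp add: form_xy h_def a_minus_def)
  define J where "J = PIdl\<^bsub>C\<^esub> (\<pi> h)"
  have J: "ideal J C" unfolding J_def using h by (simp add: \<pi>.S.cgenideal_ideal)
  have "\<pi> (h \<otimes>\<^bsub>U\<^esub> h) = \<zero>\<^bsub>C\<^esub>"
    using \<pi>_zero[of "h \<otimes>\<^bsub>U\<^esub> h"] h U.P.cgenideal_self[of "h \<otimes>\<^bsub>U\<^esub> h"] by (simp add: H_def)
  then have hh: "\<pi> h \<otimes>\<^bsub>C\<^esub> \<pi> h = \<zero>\<^bsub>C\<^esub>" using h by simp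
  have sq: "s \<otimes>\<^bsub>C\<^esub> t = \<zero>\<^bsub>C\<^esub>" if "s \<in> J" "t \<in> J" for s t
  proof -
    obtain p q where p: "p \<in> carrier C" "s = p \<otimes>\<^bsub>C\<^esub> \<pi> h" and q: "q \<in> carrier C" "t = q \<otimes>\<^bsub>C\<^esub> \<pi> h"
      using \<open>s \<in> J\<close> \<open>t \<in> J\<close> by (auto simp: J_def cgenideal_def)
    have "s \<otimes>\<^bsub>C\<^esub> t = (p \<otimes>\<^bsub>C\<^esub> q) \<otimes>\<^bsub>C\<^esub> (\<pi> h \<otimes>\<^bsub>C\<^esub> \<pi> h)"
      using p q h by (simp add: \<pi>.S.m_ac)
    then show ?thesis using p q by (simp add: hh)
  qed
  \<comment> \<open>\<open>C\<close> does not live on the type over which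
    \<open>formally_smooth\<close> quantifies, so the lifting property is transferred first.\<close>
  note lift = formally_smooth_lifting[OF structure_map_hom fs \<pi>.S.cring_axioms,
      unfolded infinitesimal_lifting_iff[OF \<pi>.S.cring_axioms]]
  have "quadratic_form C (\<psi> a) (\<psi> b) (\<psi> c) x y \<ominus>\<^bsub>C\<^esub> \<one>\<^bsub>C\<^esub> \<in> J"
    unfolding psi_b form_h J_def by (rule \<pi>.S.cgenideal_self[OF \<pi>.hom_closed[OF h]])
  with psi J sq xy have prem: "ring_hom_cring B C \<psi> \<and> ideal J C \<and>
      (\<forall>s \<in> J. \<forall>t \<in> J. s \<otimes>\<^bsub>C\<^esub> t = \<zero>\<^bsub>C\<^esub>) \<and> x \<in> carrier C \<and> y \<in> carrier C \<and>
      quadratic_form C (\<psi> a) (\<psi> b) (\<psi> c) x y \<ominus>\<^bsub>C\<^esub> \<one>\<^bsub>C\<^esub> \<in> J"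
    by blast
  note lift[THEN spec, THEN spec, THEN spec, THEN spec, THEN mp, OF prem]
  then obtain x' y' where "x' \<in> carrier C" "y' \<in> carrier C" "x' \<ominus>\<^bsub>C\<^esub> x \<in> J" "y' \<ominus>\<^bsub>C\<^esub> y \<in> J"
    and form: "quadratic_form C (\<psi> a) \<zero>\<^bsub>C\<^esub> (\<psi> c) x' y' = \<one>\<^bsub>C\<^esub>"
    unfolding psi_b by blast
  \<comment> \<open>The form does not change when the point moves within \<open>J\<close>, so the
    original point already satisfies the equation.\<close>
  then have "quadratic_form C (\<psi> a) \<zero>\<^bsub>C\<^esub> (\<psi> c) x y = \<one>\<^bsub>C\<^esub>"
    using \<pi>.S.quadratic_form_char_two_cong[OF J sq two, of "\<psi> a" "\<psi> c" x y x' y'] xy by simp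
  then have "\<pi> h = \<zero>\<^bsub>C\<^esub>" unfolding form_h[symmetric] by (simp add: \<pi>.S.r_right_minus_eq)
  then have "h \<in> H" using \<pi>_zero[OF h] by simp
  then obtain g where "g \<in> carrier U" "h = g \<otimes>\<^bsub>U\<^esub> (h \<otimes>\<^bsub>U\<^esub> h)"
    unfolding H_def cgenideal_def by blast
  then obtain n :: nat where "\<rho> d [^]\<^bsub>Q\<^esub> n = \<zero>\<^bsub>Q\<^esub>"
    using U.nilpotent_if_square_dvd_self[OF \<rho>.hom_closed[OF d] _ h_def] by blast
  then have "d [^] n \<in> I" using \<rho>_zero[of "d [^] n"] d by simp
  then show ?thesis using d by (auto simp: radical_ideal_def I_def)
qed

lemma (in quadric) radical_imp_formally_smooth:
  assumes "a \<in> radical_ideal B (Idl {\<one> \<oplus> \<one>, b})" "c \<in> radical_ideal B (Idl {\<one> \<oplus> \<one>, b})"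
  shows "formally_smooth B A \<phi>"
proof -
  obtain n m :: nat where nm: "a [^] n \<in> Idl {\<one> \<oplus> \<one>, b}" "c [^] m \<in> Idl {\<one> \<oplus> \<one>, b}"
    using assms by (auto simp: radical_ideal_def)
  have "infinitesimal_lifting B A \<phi> C" if C: "cring C" for C :: "((nat multiset \<Rightarrow> 'a) set + 'a) list list ring"
    unfolding infinitesimal_lifting_iff[OF C]
  proof (intro allI impI, elim conjE)
    fix \<psi> J x y
    assume psi: "ring_hom_cring B C \<psi>" and J: "ideal J C" and sq: "\<forall>s \<in> J. \<forall>t \<in> J. s \<otimes>\<^bsub>C\<^esub> t = \<zero>\<^bsub>C\<^esub>"
      and xy: "x \<in> carrier C" "y \<in> carrier C"
      and in_J: "quadratic_form C (\<psi> a) (\<psi> b) (\<psi> c) x y \<ominus>\<^bsub>C\<^esub> \<one>\<^bsub>C\<^esub> \<in> J"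
    interpret \<psi>: ring_hom_cring B C \<psi> by (rule psi)
    show "\<exists>x' y'. x' \<in> carrier C \<and> y' \<in> carrier C \<and> x' \<ominus>\<^bsub>C\<^esub> x \<in> J \<and> y' \<ominus>\<^bsub>C\<^esub> y \<in> J \<and>
        quadratic_form C (\<psi> a) (\<psi> b) (\<psi> c) x' y' = \<one>\<^bsub>C\<^esub>"
    proof (rule \<psi>.S.quadric_newton_step[OF J _ _ _ _ xy in_J])
      fix T assume T: "ideal T C" "\<one>\<^bsub>C\<^esub> \<oplus>\<^bsub>C\<^esub> \<one>\<^bsub>C\<^esub> \<in> T" "\<psi> b \<in> T"
      \<comment> \<open>The preimage of \<open>T\<close> under \<open>\<psi>\<close> is an ideal of
        \<open>B\<close> that contains 2 and \<open>b\<close>, hence also the given powers of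
        \<open>a\<close> and \<open>c\<close>.\<close>
      have "Idl {\<one> \<oplus> \<one>, b} \<subseteq> {r \<in> carrier B. \<psi> r \<in> T}"
        by (rule genideal_minimal[OF \<psi>.ring.ideal_vimage[OF T(1)]]) (use T in simp)
      then have "\<psi> (a [^] n) \<in> T" "\<psi> (c [^] m) \<in> T" using nm by auto
      then show "(\<exists>n::nat. \<psi> a [^]\<^bsub>C\<^esub> n \<in> T) \<and> (\<exists>n::nat. \<psi> c [^]\<^bsub>C\<^esub> n \<in> T)"
        by auto
    qed (use sq in simp_all)
  qed
  then show ?thesis unfolding formally_smooth_def by blast
qed

theorem theorem2p1:
  fixes B :: "('b, 'm) ring_scheme" (structure)
    and a b c :: 'b
  assumes "cring B"
    and "a \<in> carrier B" and "b \<in> carrier B" and "c \<in> carrier B"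
  shows "smooth_algebra B (quadric_algebra B a b c) (quadric_structure_map B a b c) \<longleftrightarrow>
    a \<in> radical_ideal B (Idl {\<one> \<oplus> \<one>, b}) \<and> c \<in> radical_ideal B (Idl {\<one> \<oplus> \<one>, b})"
proof -
  interpret quadric B a b c
    using assms by (intro quadric.intro quadric_axioms.intro)
  show ?thesis
  proof
    assume "smooth_algebra B (quadric_algebra B a b c) (quadric_structure_map B a b c)"
    then have fs: "formally_smooth B (quadric_algebra B a b c) (quadric_structure_map B a b c)"
      by (simp add: smooth_algebra_def)
    show "a \<in> radical_ideal B (Idl {\<one> \<oplus> \<one>, b}) \<and> c \<in> radical_ideal B (Idl {\<one> \<oplus> \<one>, b})"
    proof
      show "a \<in> radical_ideal B (Idl {\<one> \<oplus> \<one>, b})"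
      proof (rule formally_smooth_imp_radical[OF fs assms(2)])
        fix C :: "(nat \<Rightarrow> 'b set) set ring" and \<psi> z
        assume "ring_hom_cring B C \<psi>" and z: "z \<in> carrier C"
        then interpret \<psi>: ring_hom_cring B C \<psi> by simp
        \<comment> \<open>The point (z, 0) isolates the coefficient \<open>a\<close>; for
          \<open>c\<close> the point (0, z) is used.\<close>
        show "\<exists>x \<in> carrier C. \<exists>y \<in> carrier C.
            quadratic_form C (\<psi> a) \<zero>\<^bsub>C\<^esub> (\<psi> c) x y = \<psi> a \<otimes>\<^bsub>C\<^esub> (z \<otimes>\<^bsub>C\<^esub> z)"
          using z by (intro bexI[of _ z] bexI[of _ "\<zero>\<^bsub>C\<^esub>"]) (simp_all add: quadratic_form_def)
      qed
      show "c \<in> radical_ideal B (Idl {\<one> \<oplus> \<one>, b})"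
      proof (rule formally_smooth_imp_radical[OF fs assms(4)])
        fix C :: "(nat \<Rightarrow> 'b set) set ring" and \<psi> z
        assume "ring_hom_cring B C \<psi>" and z: "z \<in> carrier C"
        then interpret \<psi>: ring_hom_cring B C \<psi> by simp
        show "\<exists>x \<in> carrier C. \<exists>y \<in> carrier C.
            quadratic_form C (\<psi> a) \<zero>\<^bsub>C\<^esub> (\<psi> c) x y = \<psi> c \<otimes>\<^bsub>C\<^esub> (z \<otimes>\<^bsub>C\<^esub> z)"
          using z by (intro bexI[of _ "\<zero>\<^bsub>C\<^esub>"] bexI[of _ z]) (simp_all add: quadratic_form_def)
      qed
    qed
  next
    assume "a \<in> radical_ideal B (Idl {\<one> \<oplus> \<one>, b}) \<and> c \<in> radical_ideal B (Idl {\<one> \<oplus> \<one>, b})"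
    then show "smooth_algebra B (quadric_algebra B a b c) (quadric_structure_map B a b c)"
      using structure_map_hom quadric_finitely_presented radical_imp_formally_smooth
      by (simp add: smooth_algebra_def)
  qed
qed

end
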